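(* For all real $p,q>1$, writing $p'=p/(p-1)$ and, for $c>0$, $$\alpha(c,q)=\frac{2\sqrt{\pi}}{(e\,q)^{1/q}}\left(\frac{q(q+4)+8}{q^3}+c\right)^{1/6},$$ the following hold. (1) $$\left(\frac{p}{p-1}\right)^{1/q}\alpha\left(\frac1{100},q\right)<\pi_{p,q}<\left(\frac{pq+p-q}{q(p-1)}\right)^{1-1/q}\left(\frac{p}{p-1}\right)^{1/q}\alpha\left(\frac1{30},q\right).$$ (2) $$2^{1-2/p}\sqrt{\frac{\pi}{p}(4+p)}<\pi_{p',p}<2^{1-2/p}\sqrt{\frac{\pi}{p}(4+p)+\left(2\sqrt{\pi}\,\frac{\Gamma(3/4)}{\Gamma(1/4)}\right)^2}.$$ (3) $$2^{2/p}\sqrt{\pi}\,\sqrt{\frac54-\frac1p}<\pi_{p,p'}<2^{2/p}\sqrt{\pi}\,\frac{(2-1/p)^{3/2-1/p}}{\sqrt{e}\,(3/2-1/p)^{1-1/p}}.$$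
   Context: For real $p,q>1$, the constant $\pi_{p,q}$ is defined by $$\pi_{p,q}=2\int_0^1(1-t^q)^{-1/p}\,dt=\frac{2}{q}B\left(1-\frac1p,\frac1q\right),$$ where $B(a,b)=\Gamma(a)\Gamma(b)/\Gamma(a+b)$ is the beta function and $\Gamma$ is the gamma function. Without subscripts, $\pi$ is the usual constant $3.14\ldots$ and $e$ is the base of the natural logarithm. $\pi_{p',p}$ and $\pi_{p,p'}$ denote the constant $\pi_{a,b}$ with $(a,b)=(p',p)$ and $(a,b)=(p,p')$, respectively. *)

theory Defs
  imports "HOL-Analysis.Analysis"
begin

text \<open>The integrand is unbounded at 1; its value there is irrelevant, and the integral is the
  (unique) finite Henstock-Kurzweil integral, see the lemma below.\<close>

definition pi_pq :: "real \<Rightarrow> real \<Rightarrow> real" where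
  "pi_pq p q = 2 * integral {0..1} (\<lambda>t. (1 - t powr q) powr (- 1 / p))"

definition alpha :: "real \<Rightarrow> real \<Rightarrow> real" where
  "alpha c q =
     2 * sqrt pi / (exp 1 * q) powr (1 / q) * ((q * (q + 4) + 8) / q ^ 3 + c) powr (1 / 6)"

lemma pi_pq_Beta:
  fixes p q :: real
  assumes p: "p > 1" and q: "q > 1"
  shows "(\<lambda>t. (1 - t powr q) powr (- 1 / p)) integrable_on {0..1}"
    and "pi_pq p q = 2 / q * Beta (1 - 1 / p) (1 / q)"
proof -
  let ?F = "\<lambda>t. (1 - t powr q) powr (- 1 / p)"
  let ?f = "\<lambda>u. u powr (1 / q - 1) * (1 - u) powr (- 1 / p)"
  let ?g = "\<lambda>t. t powr q"
  let ?S = "{0<..<1::real}"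
  have eq0: "(?f has_integral Beta (1 / q) (1 - 1 / p)) {0..1}"
    using has_integral_Beta_real[of "1 / q" "1 - 1 / p"] p q by simp
  have "negligible {x \<in> {0..1} - ?S. h x \<noteq> 0}" "negligible {x \<in> ?S - {0..1}. h x \<noteq> 0}"
    for h :: "real \<Rightarrow> real"
    by (rule negligible_subset[of "{0, 1}"], auto)+
  then have spike: "(h has_integral y) {0..1} \<longleftrightarrow> (h has_integral y) ?S" for h :: "real \<Rightarrow> real" and y
    by (rule has_integral_spike_set_eq)
  have img: "?g ` ?S = ?S"
  proof (intro equalityI subsetI)
    fix u assume "u \<in> ?g ` ?S"
    then show "u \<in> ?S" using q powr_less_mono2[of q _ 1] by auto
  next
    fix u assume u: "u \<in> ?S"
    then have "u = ?g (u powr (1 / q))" using q by (simp add: powr_powr)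
    moreover have "u powr (1 / q) \<in> ?S" using u q powr_less_mono2[of "1 / q" u 1] by auto
    ultimately show "u \<in> ?g ` ?S" by blast
  qed
  have abs: "?f absolutely_integrable_on ?g ` ?S" "integral (?g ` ?S) ?f = Beta (1 / q) (1 - 1 / p)"
  proof -
    have "(?f has_integral Beta (1 / q) (1 - 1 / p)) ?S" using eq0 spike by blast
    then show "?f absolutely_integrable_on ?g ` ?S" "integral (?g ` ?S) ?f = Beta (1 / q) (1 - 1 / p)"
      unfolding img
      by (auto intro!: nonnegative_absolutely_integrable_1 simp: integral_unique has_integral_integrable)
  qed
  have der: "(?g has_field_derivative q * t powr (q - 1)) (at t within ?S)" if "t \<in> ?S" for t
    using that by (intro DERIV_subset[OF has_real_derivative_powr]) auto
  have inj: "inj_on ?g ?S"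
  proof (rule inj_on_inverseI)
    show "(t powr q) powr (1 / q) = t" if "t \<in> ?S" for t using that q by (simp add: powr_powr)
  qed
  have "(\<lambda>t. \<bar>q * t powr (q - 1)\<bar> * ?f (?g t)) absolutely_integrable_on ?S \<and>
        integral ?S (\<lambda>t. \<bar>q * t powr (q - 1)\<bar> * ?f (?g t)) = Beta (1 / q) (1 - 1 / p)"
    using abs by (subst has_absolute_integral_change_of_variables_1'[OF _ der inj]) auto
  then have "((\<lambda>t. \<bar>q * t powr (q - 1)\<bar> * ?f (?g t)) has_integral Beta (1 / q) (1 - 1 / p)) ?S"
    by (simp add: absolutely_integrable_on_def has_integral_iff)
  moreover have "\<bar>q * t powr (q - 1)\<bar> * ?f (?g t) = q * ?F t" if "t \<in> ?S" for t
  proof -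
    have "t powr (q - 1) * t powr (q * (1 / q - 1)) = 1"
      using that q by (simp add: powr_add[symmetric] algebra_simps)
    then show ?thesis using that q by (simp add: abs_mult powr_powr algebra_simps)
  qed
  ultimately have "((\<lambda>t. q * ?F t) has_integral Beta (1 / q) (1 - 1 / p)) ?S"
    by (subst (asm) has_integral_cong) auto
  from has_integral_mult_right[OF this, of "1 / q"]
  have "(?F has_integral 1 / q * Beta (1 / q) (1 - 1 / p)) ?S" using q by simp
  then have *: "(?F has_integral 1 / q * Beta (1 - 1 / p) (1 / q)) {0..1}"
    by (subst spike) (simp add: Beta_commute)
  show "?F integrable_on {0..1}" using * by blast
  show "pi_pq p q = 2 / q * Beta (1 - 1 / p) (1 / q)"
    unfolding pi_pq_def using integral_unique[OF *] by simp
qed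

end

theory Submission
  imports Defs "HOL-Real_Asymp.Real_Asymp"
begin

text \<open>Put \<open>a = 1 - 1/p\<close> and \<open>s = 1/q\<close>. The beta integral gives
\<open>pi_pq p q = 2 \<Gamma>(a) \<Gamma>(1 + s) / \<Gamma>(a + s)\<close>, so all the estimates are statements about the gamma function.

In the first pair of bounds, \<open>\<Gamma>(a) / \<Gamma>(a + s)\<close> is compared with powers of \<open>a\<close> and \<open>a + s\<close> by
log-convexity (\<open>Gamma_ratio_le\<close>, \<open>Gamma_ratio_ge\<close>), and \<open>alpha c q\<close> is twice Ramanujan's approximation
\<open>\<surd>\<pi> (s/e)^s (8s^3 + 4s^2 + s + c)^(1/6)\<close> of \<open>\<Gamma>(1 + s)\<close>. It remains to prove Ramanujan's inequality on
\<open>(0,1)\<close>: the approximation is too small for \<open>c = 1/100\<close> and too large for \<open>c = 1/30\<close>. This is delicate,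
since for \<open>c = 1/100\<close> the logarithms of the two sides come within about \<open>1.5/10^6\<close> of each other near
\<open>s = 27/40\<close>. The logarithmic difference, \<open>ramanujan_gap c\<close>, has a second derivative that is a rational
function plus the trigamma function. Rational bounds for the trigamma function turn the sign of the
second derivative into the sign of a polynomial on an interval, which is certified by nonnegative
coefficients in the Bernstein basis. Convexity or concavity then reduces the inequality to the value and
slope of the gap at a few rational points, and these follow from Stirling's series with explicit
error and from decimal bounds for the logarithms of 2, 3, 5 and 7.

For the trigamma function, the first terms \<open>R\<close> of the asymptotic series satisfy
\<open>R x - R (x + 1) \<le> 1/x^2\<close> or the reverse, according to the parity of the number of terms; summing over
\<open>x, x + 1, \<dots>\<close> compares \<open>R\<close> with the trigamma function. Integrating from infinity gives the bounds for the
digamma function and then for \<open>ln_Gamma\<close>, where Legendre's duplication formula identifies the constant of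
integration as \<open>ln (2 \<pi>) / 2\<close>.

The other two pairs concern the case \<open>a = s\<close>. There duplication gives
\<open>pi_pq p q = 2^(2 - 2s) \<surd>\<pi> \<Gamma>(s + 1) / \<Gamma>(s + 1/2)\<close>. The square of this gamma quotient lies strictly between
\<open>s + 1/4\<close> and \<open>s + 1/3\<close>: its ratio to \<open>s + c\<close> tends to 1 along \<open>s, s + 1, \<dots>\<close>, decreasing for \<open>c = 1/4\<close> and
increasing for \<open>c = 1/3\<close>. As \<open>1/12 < (\<Gamma>(3/4) / \<Gamma>(1/4))^2\<close>, which is itself a consequence of the upper
bound at \<open>s = 1/4\<close>, this yields the second pair and the lower half of the third. The last upper bound
expresses that \<open>ln \<Gamma>(x) - (x - 1/2) ln x + x\<close> is strictly decreasing.\<close>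

section \<open>Rational bounds for the trigamma function\<close>

text \<open>Both \<open>R x\<close> and the trigamma function are sums over \<open>k\<close>, of \<open>R (x + k) - R (x + k + 1)\<close> and of \<open>1 / (x + k)^2\<close>
respectively, so they can be compared term by term.\<close>

lemma Polygamma_1_ge_telescoping:
  fixes R :: "real \<Rightarrow> real"
  assumes x: "x > 0"
    and step: "\<And>y. y > 0 \<Longrightarrow> R y - R (y + 1) \<le> 1 / y\<^sup>2"
    and lim: "(R \<longlongrightarrow> 0) at_top"
  shows "R x \<le> Polygamma 1 x"
proof -
  have "(\<lambda>k. inverse ((x + of_nat k) ^ Suc 1)) sums ((-1) ^ Suc 1 * Polygamma 1 x / fact 1)"
    using x by (intro Polygamma_LIMSEQ) auto
  then have S: "(\<lambda>k. 1 / (x + real k)\<^sup>2) sums Polygamma 1 x"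
    by (simp add: inverse_eq_divide power2_eq_square)
  have "(\<lambda>k. R (x + real k)) \<longlonglongrightarrow> 0"
    by (rule filterlim_compose[OF lim]) real_asymp
  from telescope_sums'[OF this] have T: "(\<lambda>k. R (x + real k) - R (x + real (Suc k))) sums R x"
    by simp
  show ?thesis
  proof (rule sums_le[OF _ T S])
    fix k show "R (x + real k) - R (x + real (Suc k)) \<le> 1 / (x + real k)\<^sup>2"
      using step[of "x + real k"] x by (simp add: add_ac)
  qed
qed

lemma Polygamma_1_le_telescoping:
  fixes R :: "real \<Rightarrow> real"
  assumes x: "x > 0"
    and step: "\<And>y. y > 0 \<Longrightarrow> R y - R (y + 1) \<ge> 1 / y\<^sup>2"
    and lim: "(R \<longlongrightarrow> 0) at_top"
  shows "Polygamma 1 x \<le> R x"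
proof -
  have "(\<lambda>k. inverse ((x + of_nat k) ^ Suc 1)) sums ((-1) ^ Suc 1 * Polygamma 1 x / fact 1)"
    using x by (intro Polygamma_LIMSEQ) auto
  then have S: "(\<lambda>k. 1 / (x + real k)\<^sup>2) sums Polygamma 1 x"
    by (simp add: inverse_eq_divide power2_eq_square)
  have "(\<lambda>k. R (x + real k)) \<longlonglongrightarrow> 0"
    by (rule filterlim_compose[OF lim]) real_asymp
  from telescope_sums'[OF this] have T: "(\<lambda>k. R (x + real k) - R (x + real (Suc k))) sums R x"
    by simp
  show ?thesis
  proof (rule sums_le[OF _ S T])
    fix k show "1 / (x + real k)\<^sup>2 \<le> R (x + real k) - R (x + real (Suc k))"
      using step[of "x + real k"] x by (simp add: add_ac)
  qed
qed

text \<open>The next two bounds are consecutive partial sums of the asymptotic series of the trigamma function,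
so they enclose it with an error of the size of the last term.\<close>

lemma Polygamma_1_lower:
  fixes x :: real
  assumes "x > 0"
  shows "1 / x + 1 / (2 * x ^ 2) + 1 / (6 * x ^ 3) - 1 / (30 * x ^ 5) \<le> Polygamma 1 x"
proof (rule Polygamma_1_ge_telescoping[OF assms])
  fix y :: real assume y: "y > 0"
  let ?R = "\<lambda>x::real. 1 / x + 1 / (2 * x ^ 2) + 1 / (6 * x ^ 3) - 1 / (30 * x ^ 5)"
  have "1 / y\<^sup>2 - (?R y - ?R (y + 1)) = (5 * y\<^sup>2 + 5 * y + 1) / (30 * y ^ 5 * (y + 1) ^ 5)"
    using y by (simp add: divide_simps) algebra
  also have "\<dots> \<ge> 0" using y by simp
  finally show "?R y - ?R (y + 1) \<le> 1 / y\<^sup>2" by simp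
next
  show "((\<lambda>x::real. 1 / x + 1 / (2 * x ^ 2) + 1 / (6 * x ^ 3) - 1 / (30 * x ^ 5)) \<longlongrightarrow> 0) at_top"
    by real_asymp
qed

lemma Polygamma_1_upper:
  fixes x :: real
  assumes "x > 0"
  shows "Polygamma 1 x \<le> 1 / x + 1 / (2 * x ^ 2) + 1 / (6 * x ^ 3) - 1 / (30 * x ^ 5) + 1 / (42 * x ^ 7)"
proof (rule Polygamma_1_le_telescoping[OF assms])
  fix y :: real assume y: "y > 0"
  let ?R = "\<lambda>x::real. 1 / x + 1 / (2 * x ^ 2) + 1 / (6 * x ^ 3) - 1 / (30 * x ^ 5) + 1 / (42 * x ^ 7)"
  have "(?R y - ?R (y + 1)) - 1 / y\<^sup>2 =
      (63 * y ^ 4 + 126 * y ^ 3 + 98 * y\<^sup>2 + 35 * y + 5) / (210 * y ^ 7 * (y + 1) ^ 7)"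
    using y by (simp add: divide_simps) algebra
  also have "\<dots> \<ge> 0" using y by simp
  finally show "?R y - ?R (y + 1) \<ge> 1 / y\<^sup>2" by simp
next
  show "((\<lambda>x::real. 1 / x + 1 / (2 * x ^ 2) + 1 / (6 * x ^ 3) - 1 / (30 * x ^ 5) + 1 / (42 * x ^ 7)) \<longlongrightarrow> 0) at_top"
    by real_asymp
qed

section \<open>Bounds for the digamma function\<close>

lemma Digamma_minus_ln_tendsto_0:
  fixes z :: real
  assumes "z > 0"
  shows "(\<lambda>n. Digamma (z + real n) - ln (real n)) \<longlonglongrightarrow> 0"
proof -
  have "(\<lambda>m. of_real (ln (real m)) - (\<Sum>n<m. inverse (z + of_nat n))) \<longlonglongrightarrow> Digamma z"
    using assms by (intro Digamma_LIMSEQ) auto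
  from tendsto_diff[OF tendsto_const[of "Digamma z"] this]
  have "(\<lambda>m. Digamma z - (ln (real m) - (\<Sum>n<m. inverse (z + real n)))) \<longlonglongrightarrow> 0" by simp
  moreover have "Digamma z - (ln (real m) - (\<Sum>n<m. inverse (z + real n)))
      = Digamma (z + real m) - ln (real m)" for m
  proof -
    have "z + real k \<noteq> 0" if "k < m" for k using assms by simp
    then show ?thesis
      using assms by (subst Polygamma_plus_of_nat) (auto simp: inverse_eq_divide add_eq_0_iff)
  qed
  ultimately show ?thesis by simp
qed

lemma has_real_derivative_inverse_power:
  fixes y k :: real
  assumes "y > 0"
  shows "((\<lambda>x. 1 / (k * x ^ n)) has_real_derivative - (real n / (k * y ^ Suc n))) (at y)"
proof (cases "n = 0 \<or> k = 0")
  case False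
  then obtain m where m: "n = Suc m" by (cases n) auto
  have "((\<lambda>x. 1 / (k * x ^ n)) has_real_derivative
      - (k * (real n * y ^ m)) / ((k * y ^ n) * (k * y ^ n))) (at y)"
    using DERIV_inverse'[OF DERIV_cmult[OF DERIV_pow[of n y], of k]] assms False
    by (simp add: inverse_eq_divide m)
  also have "- (k * (real n * y ^ m)) / ((k * y ^ n) * (k * y ^ n)) = - (real n / (k * y ^ Suc n))"
    using assms False by (simp add: m divide_simps)
  finally show ?thesis .
qed auto

text \<open>The form in which inequalities are integrated from infinity below: the limit is needed only along
\<open>x, x + 1, \<dots>\<close>, where the recurrences of the gamma and digamma functions apply.\<close>

lemma nondecreasing_le_shift_limit:
  fixes f f' :: "real \<Rightarrow> real"
  assumes x: "x > 0"
    and der: "\<And>y. y > 0 \<Longrightarrow> (f has_real_derivative f' y) (at y)"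
    and nonneg: "\<And>y. y > 0 \<Longrightarrow> f' y \<ge> 0"
    and lim: "(\<lambda>n. f (x + real n)) \<longlonglongrightarrow> c"
  shows "f x \<le> c"
proof (rule LIMSEQ_le_const[OF lim], intro exI allI impI)
  fix n :: nat
  show "f x \<le> f (x + real n)"
  proof (rule DERIV_nonneg_imp_nondecreasing[where f = f])
    fix t assume "x \<le> t"
    with x have "t > 0" by simp
    then show "\<exists>d. (f has_real_derivative d) (at t) \<and> 0 \<le> d"
      using der nonneg by blast
  qed simp
qed

lemma Digamma_upper:
  fixes x :: real
  assumes x: "x > 0"
  shows "Digamma x \<le> ln x - 1 / (2 * x) - 1 / (12 * x ^ 2) + 1 / (120 * x ^ 4)"
proof -
  define f where "f = (\<lambda>x::real. Digamma x - (ln x - 1 / (2 * x) - 1 / (12 * x ^ 2) + 1 / (120 * x ^ 4)))"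
  have "f x \<le> 0"
  proof (rule nondecreasing_le_shift_limit[OF x])
    fix y :: real assume y: "y > 0"
    then have "y \<notin> \<int>\<^sub>\<le>\<^sub>0" by auto
    with y show "(f has_real_derivative Polygamma 1 y -
        (1 / y + 1 / (2 * y ^ 2) + 1 / (6 * y ^ 3) - 1 / (30 * y ^ 5))) (at y)"
      unfolding f_def
      by (auto intro!: derivative_eq_intros simp: field_simps power2_eq_square eval_nat_numeral)
    show "0 \<le> Polygamma 1 y - (1 / y + 1 / (2 * y ^ 2) + 1 / (6 * y ^ 3) - 1 / (30 * y ^ 5))"
      using Polygamma_1_lower[OF y] by simp
  next
    have "(\<lambda>n. ln (x + real n) - ln (real n) - 1 / (2 * (x + real n)) - 1 / (12 * (x + real n) ^ 2)
        + 1 / (120 * (x + real n) ^ 4)) \<longlonglongrightarrow> 0"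
      by real_asymp
    from tendsto_diff[OF Digamma_minus_ln_tendsto_0[OF x] this]
    show "(\<lambda>n. f (x + real n)) \<longlonglongrightarrow> 0" by (simp add: f_def algebra_simps)
  qed
  then show ?thesis by (simp add: f_def)
qed

lemma Digamma_lower:
  fixes x :: real
  assumes x: "x > 0"
  shows "ln x - 1 / (2 * x) - 1 / (12 * x ^ 2) + 1 / (120 * x ^ 4) - 1 / (252 * x ^ 6) \<le> Digamma x"
proof -
  define f where "f = (\<lambda>x::real. (ln x - 1 / (2 * x) - 1 / (12 * x ^ 2) + 1 / (120 * x ^ 4)
     - 1 / (252 * x ^ 6)) - Digamma x)"
  have "f x \<le> 0"
  proof (rule nondecreasing_le_shift_limit[OF x])
    fix y :: real assume y: "y > 0"
    then have "y \<notin> \<int>\<^sub>\<le>\<^sub>0" by auto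
    with y show "(f has_real_derivative (1 / y + 1 / (2 * y ^ 2) + 1 / (6 * y ^ 3) - 1 / (30 * y ^ 5)
        + 1 / (42 * y ^ 7)) - Polygamma 1 y) (at y)"
      unfolding f_def
      by (auto intro!: derivative_eq_intros simp: field_simps power2_eq_square eval_nat_numeral)
    show "0 \<le> (1 / y + 1 / (2 * y ^ 2) + 1 / (6 * y ^ 3) - 1 / (30 * y ^ 5)
        + 1 / (42 * y ^ 7)) - Polygamma 1 y"
      using Polygamma_1_upper[OF y] by simp
  next
    have "(\<lambda>n. ln (x + real n) - ln (real n) - 1 / (2 * (x + real n)) - 1 / (12 * (x + real n) ^ 2)
        + 1 / (120 * (x + real n) ^ 4) - 1 / (252 * (x + real n) ^ 6)) \<longlonglongrightarrow> 0"
      by real_asymp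
    from tendsto_diff[OF this Digamma_minus_ln_tendsto_0[OF x]]
    show "(\<lambda>n. f (x + real n)) \<longlonglongrightarrow> 0" by (simp add: f_def algebra_simps)
  qed
  then show ?thesis by (simp add: f_def)
qed

lemma Digamma_less:
  fixes x :: real
  assumes x: "x \<ge> 1 / 2"
  shows "Digamma x < ln x - 1 / (2 * x)"
proof -
  have "1 * 1 / 4 \<le> x * x" using x by (intro order.trans[OF _ mult_mono[of "1/2" x "1/2" x]]) auto
  then have "1 / (120 * x ^ 4) < 1 / (12 * x ^ 2)"
    using x by (simp add: divide_simps eval_nat_numeral)
  then show ?thesis using Digamma_upper[of x] x by simp
qed

section \<open>Stirling's formula with explicit error\<close>

lemma Gamma_legendre_duplication_real:
  fixes x :: real
  assumes x: "x > 0"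
  shows "Gamma x * Gamma (x + 1 / 2) = 2 powr (1 - 2 * x) * sqrt pi * Gamma (2 * x)"
proof -
  have n: "complex_of_real x \<notin> \<int>\<^sub>\<le>\<^sub>0" "complex_of_real x + 1 / 2 \<notin> \<int>\<^sub>\<le>\<^sub>0"
    using x by (auto elim!: nonpos_Ints_cases simp: complex_eq_iff)
  have "complex_of_real (Gamma x * Gamma (x + 1 / 2)) =
      Gamma (of_real x) * Gamma (of_real x + 1 / 2)"
    by (simp flip: Gamma_complex_of_real)
  also have "\<dots> = exp ((1 - 2 * of_real x) * of_real (ln 2)) * of_real (sqrt pi) * Gamma (2 * of_real x)"
    by (rule Gamma_legendre_duplication[OF n])
  also have "\<dots> = of_real (exp ((1 - 2 * x) * ln 2) * sqrt pi * Gamma (2 * x))"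
    by (simp flip: Gamma_complex_of_real exp_of_real)
  finally show ?thesis
    by (simp only: of_real_eq_iff) (simp add: powr_def)
qed

lemma ln_Gamma_legendre_duplication:
  fixes x :: real
  assumes x: "x > 0"
  shows "ln_Gamma x + ln_Gamma (x + 1 / 2) = (1 - 2 * x) * ln 2 + ln pi / 2 + ln_Gamma (2 * x)"
proof -
  have "ln_Gamma x + ln_Gamma (x + 1 / 2) = ln (Gamma x * Gamma (x + 1 / 2))"
    using x Gamma_real_pos[of x] Gamma_real_pos[of "x + 1 / 2"]
    by (subst ln_mult) (auto simp: ln_Gamma_real_pos simp del: Gamma_real_pos)
  also have "\<dots> = (1 - 2 * x) * ln 2 + ln pi / 2 + ln_Gamma (2 * x)"
    unfolding Gamma_legendre_duplication_real[OF x]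
    using x Gamma_real_pos[of "2 * x"]
    by (subst ln_mult) (auto simp: ln_Gamma_real_pos ln_mult ln_sqrt simp del: Gamma_real_pos)
  finally show ?thesis .
qed

definition stirling_diff :: "real \<Rightarrow> real" where
  "stirling_diff x = ln_Gamma x - ((x - 1 / 2) * ln x - x)"

lemma stirling_diff_deriv:
  assumes "x > 0"
  shows "(stirling_diff has_real_derivative Digamma x - (ln x - 1 / (2 * x))) (at x)"
  unfolding stirling_diff_def using assms
  by (auto intro!: derivative_eq_intros simp: field_simps)

lemma stirling_diff_strict_decreasing:
  assumes "1 / 2 \<le> x" "x < y"
  shows "stirling_diff y < stirling_diff x"
proof (rule DERIV_neg_imp_decreasing[OF assms(2)])
  fix t assume "x \<le> t" "t \<le> y"
  then have t: "t \<ge> 1 / 2" using assms by simp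
  show "\<exists>d. (stirling_diff has_real_derivative d) (at t) \<and> d < 0"
    using stirling_diff_deriv[of t] Digamma_less[OF t] t
    by (intro exI[of _ "Digamma t - (ln t - 1 / (2 * t))"]) auto
qed

text \<open>A limit \<open>c\<close> exists because \<open>stirling_diff\<close> is decreasing while \<open>stirling_diff x - 1 / (12 x)\<close> is
increasing. Its value follows from the duplication formula, which expresses
\<open>stirling_diff x + stirling_diff (x + 1/2) - stirling_diff (2 x)\<close> by elementary functions, while this
combination tends to \<open>c + c - c\<close>.\<close>

lemma stirling_diff_tendsto: "(stirling_diff \<longlongrightarrow> ln (2 * pi) / 2) at_top"
proof -
  have bounded: "stirling_diff 1 - 1 / 12 \<le> stirling_diff x" if "x \<ge> 1" for x
  proof -
    define g where "g = (\<lambda>x. stirling_diff x - 1 / (12 * x))"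
    have "g 1 \<le> g x"
    proof (rule DERIV_nonneg_imp_nondecreasing[OF that])
      fix t :: real assume "1 \<le> t"
      then have t: "t > 0" by simp
      have "(g has_real_derivative Digamma t - (ln t - 1 / (2 * t)) + 1 / (12 * t ^ 2)) (at t)"
        using DERIV_diff[OF stirling_diff_deriv[OF t] has_real_derivative_inverse_power[OF t, of 12 1]]
        by (simp add: g_def power2_eq_square)
      moreover have "1 / (252 * t ^ 6) \<le> 1 / (120 * t ^ 4)"
      proof -
        have "120 * t ^ 4 \<le> 252 * t ^ 6"
          using \<open>1 \<le> t\<close> by (intro mult_mono power_increasing) auto
        then show ?thesis using t by (intro divide_left_mono) auto
      qed
      then have "0 \<le> Digamma t - (ln t - 1 / (2 * t)) + 1 / (12 * t ^ 2)"
        using Digamma_lower[OF t] by simp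
      ultimately show "\<exists>d. (g has_real_derivative d) (at t) \<and> 0 \<le> d" by blast
    qed
    also have "g x \<le> stirling_diff x" using that by (simp add: g_def)
    finally show ?thesis by (simp add: g_def)
  qed
  have "\<exists>c. (stirling_diff \<longlongrightarrow> c) at_top"
  proof
    define c where "c = (INF x\<in>{1..}. stirling_diff x)"
    have bdd: "bdd_below (stirling_diff ` {1..})" using bounded by (auto intro!: bdd_belowI2)
    show "(stirling_diff \<longlongrightarrow> c) at_top"
    proof (rule decreasing_tendsto)
      show "\<forall>\<^sub>F x in at_top. c \<le> stirling_diff x"
        using eventually_ge_at_top[of 1] by eventually_elim (auto simp: c_def intro!: cINF_lower bdd)
    next
      fix u assume "c < u"
      then obtain y where y: "y \<ge> 1" "stirling_diff y < u"
        unfolding c_def by (subst (asm) cINF_less_iff) (auto intro: bdd)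
      show "\<forall>\<^sub>F x in at_top. stirling_diff x < u"
        using eventually_gt_at_top[of y]
      proof eventually_elim
        case (elim x)
        with y show ?case using stirling_diff_strict_decreasing[of y x] by simp
      qed
    qed
  qed
  then obtain c where c: "(stirling_diff \<longlongrightarrow> c) at_top" by blast
  have half: "((\<lambda>x. stirling_diff (x + 1 / 2)) \<longlongrightarrow> c) at_top"
    by (rule filterlim_compose[OF c]) real_asymp
  have dbl: "((\<lambda>x. stirling_diff (2 * x)) \<longlongrightarrow> c) at_top"
    by (rule filterlim_compose[OF c]) real_asymp
  have "((\<lambda>x. stirling_diff x + stirling_diff (x + 1 / 2) - stirling_diff (2 * x)) \<longlongrightarrow> c + c - c) at_top"
    by (intro tendsto_intros c half dbl)
  moreover have "\<forall>\<^sub>F x in at_top. stirling_diff x + stirling_diff (x + 1 / 2) - stirling_diff (2 * x)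
      = ln (2 * pi) / 2 + (1 / 2 - x * ln ((x + 1 / 2) / x))"
    using eventually_gt_at_top[of 0]
  proof eventually_elim
    case (elim x)
    then have quot: "ln ((x + 1 / 2) / x) = ln (x + 1 / 2) - ln x" by (simp add: ln_div)
    have e: "ln (2 * x) = ln 2 + ln x" "ln (2 * pi) = ln 2 + ln pi"
      using elim by (simp_all add: ln_mult)
    show ?case
      unfolding stirling_diff_def quot e
      using ln_Gamma_legendre_duplication[OF elim]
      by (simp add: algebra_simps add_divide_distrib diff_divide_distrib)
  qed
  ultimately have "((\<lambda>x. ln (2 * pi) / 2 + (1 / 2 - x * ln ((x + 1 / 2) / x))) \<longlongrightarrow> c) at_top"
    by (subst (asm) tendsto_cong) auto
  moreover have "((\<lambda>x::real. ln (2 * pi) / 2 + (1 / 2 - x * ln ((x + 1 / 2) / x))) \<longlongrightarrow> ln (2 * pi) / 2 + 0) at_top"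
    by (intro tendsto_intros) real_asymp
  ultimately have "c = ln (2 * pi) / 2 + 0"
    by (rule tendsto_unique[OF trivial_limit_at_top_linorder])
  with c show ?thesis by simp
qed

lemma ln_Gamma_lower:
  fixes x :: real
  assumes x: "x > 0"
  shows "(x - 1 / 2) * ln x - x + ln (2 * pi) / 2 + 1 / (12 * x) - 1 / (360 * x ^ 3) \<le> ln_Gamma x"
proof -
  define f where "f = (\<lambda>x. 1 / (12 * x) - 1 / (360 * x ^ 3) - stirling_diff x)"
  have "f x \<le> 0 - ln (2 * pi) / 2"
  proof (rule nondecreasing_le_shift_limit[OF x])
    fix y :: real assume y: "y > 0"
    have "((\<lambda>x. 1 / (12 * x) - 1 / (360 * x ^ 3)) has_real_derivative
        - 1 / (12 * y ^ 2) + 1 / (120 * y ^ 4)) (at y)"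
      using DERIV_diff[OF has_real_derivative_inverse_power[OF y, of 12 1]
          has_real_derivative_inverse_power[OF y, of 360 3]]
      by (simp add: power2_eq_square)
    from DERIV_diff[OF this stirling_diff_deriv[OF y]]
    show "(f has_real_derivative
        (ln y - 1 / (2 * y) - 1 / (12 * y ^ 2) + 1 / (120 * y ^ 4)) - Digamma y) (at y)"
      unfolding f_def by (rule DERIV_cong) simp
    show "0 \<le> (ln y - 1 / (2 * y) - 1 / (12 * y ^ 2) + 1 / (120 * y ^ 4)) - Digamma y"
      using Digamma_upper[OF y] by simp
  next
    have "(\<lambda>n. stirling_diff (x + real n)) \<longlonglongrightarrow> ln (2 * pi) / 2"
      by (rule filterlim_compose[OF stirling_diff_tendsto]) real_asymp
    moreover have "(\<lambda>n. 1 / (12 * (x + real n)) - 1 / (360 * (x + real n) ^ 3)) \<longlonglongrightarrow> 0"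
      by real_asymp
    ultimately show "(\<lambda>n. f (x + real n)) \<longlonglongrightarrow> 0 - ln (2 * pi) / 2"
      unfolding f_def by (intro tendsto_diff)
  qed
  then show ?thesis by (simp add: f_def stirling_diff_def)
qed

lemma ln_Gamma_upper:
  fixes x :: real
  assumes x: "x > 0"
  shows "ln_Gamma x \<le> (x - 1 / 2) * ln x - x + ln (2 * pi) / 2 + 1 / (12 * x) - 1 / (360 * x ^ 3)
      + 1 / (1260 * x ^ 5)"
proof -
  define f where "f = (\<lambda>x. stirling_diff x - (1 / (12 * x) - 1 / (360 * x ^ 3) + 1 / (1260 * x ^ 5)))"
  have "f x \<le> ln (2 * pi) / 2 - 0"
  proof (rule nondecreasing_le_shift_limit[OF x])
    fix y :: real assume y: "y > 0"
    have "((\<lambda>x. 1 / (12 * x) - 1 / (360 * x ^ 3) + 1 / (1260 * x ^ 5)) has_real_derivative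
        - 1 / (12 * y ^ 2) + 1 / (120 * y ^ 4) - 1 / (252 * y ^ 6)) (at y)"
      using DERIV_add[OF DERIV_diff[OF has_real_derivative_inverse_power[OF y, of 12 1]
          has_real_derivative_inverse_power[OF y, of 360 3]]
          has_real_derivative_inverse_power[OF y, of 1260 5]]
      by (simp add: power2_eq_square)
    from DERIV_diff[OF stirling_diff_deriv[OF y] this]
    show "(f has_real_derivative Digamma y -
        (ln y - 1 / (2 * y) - 1 / (12 * y ^ 2) + 1 / (120 * y ^ 4) - 1 / (252 * y ^ 6))) (at y)"
      unfolding f_def by (rule DERIV_cong) simp
    show "0 \<le> Digamma y -
        (ln y - 1 / (2 * y) - 1 / (12 * y ^ 2) + 1 / (120 * y ^ 4) - 1 / (252 * y ^ 6))"
      using Digamma_lower[OF y] by simp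
  next
    have "(\<lambda>n. stirling_diff (x + real n)) \<longlonglongrightarrow> ln (2 * pi) / 2"
      by (rule filterlim_compose[OF stirling_diff_tendsto]) real_asymp
    moreover have "(\<lambda>n. 1 / (12 * (x + real n)) - 1 / (360 * (x + real n) ^ 3)
        + 1 / (1260 * (x + real n) ^ 5)) \<longlonglongrightarrow> 0"
      by real_asymp
    ultimately show "(\<lambda>n. f (x + real n)) \<longlonglongrightarrow> ln (2 * pi) / 2 - 0"
      unfolding f_def by (intro tendsto_diff)
  qed
  then show ?thesis by (simp add: f_def stirling_diff_def)
qed

section \<open>The gap in Ramanujan's approximation and its curvature\<close>

definition ramanujan_cubic :: "real \<Rightarrow> real \<Rightarrow> real" where
  "ramanujan_cubic c x = 8 * x ^ 3 + 4 * x ^ 2 + x + c"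

text \<open>The logarithm of \<open>\<Gamma>(1 + x)\<close> divided by \<open>\<surd>\<pi> (x/e)^x (8x^3 + 4x^2 + x + c)^(1/6)\<close>. The two definitions
that follow are its first and second derivatives.\<close>

definition ramanujan_gap :: "real \<Rightarrow> real \<Rightarrow> real" where
  "ramanujan_gap c x =
     ln_Gamma (1 + x) - (ln pi / 2 + x * ln x - x + ln (ramanujan_cubic c x) / 6)"

definition ramanujan_slope :: "real \<Rightarrow> real \<Rightarrow> real" where
  "ramanujan_slope c x =
     Digamma (1 + x) - ln x - (24 * x ^ 2 + 8 * x + 1) / (6 * ramanujan_cubic c x)"

definition ramanujan_curvature :: "real \<Rightarrow> real \<Rightarrow> real" where
  "ramanujan_curvature c x = Polygamma 1 (1 + x) - 1 / x +
     ((24 * x ^ 2 + 8 * x + 1) ^ 2 - (48 * x + 8) * ramanujan_cubic c x)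
       / (6 * ramanujan_cubic c x ^ 2)"

lemma ramanujan_cubic_pos: "c > 0 \<Longrightarrow> x \<ge> 0 \<Longrightarrow> ramanujan_cubic c x > 0"
  by (auto simp: ramanujan_cubic_def intro!: add_nonneg_pos add_nonneg_nonneg)

lemma ramanujan_gap_deriv:
  assumes "c > 0" "x > 0"
  shows "(ramanujan_gap c has_real_derivative ramanujan_slope c x) (at x)"
proof -
  have P: "(ramanujan_cubic c has_real_derivative 24 * x ^ 2 + 8 * x + 1) (at x)"
    unfolding ramanujan_cubic_def by (auto intro!: derivative_eq_intros)
  have pos: "ramanujan_cubic c x > 0" using assms by (intro ramanujan_cubic_pos) auto
  have L: "((\<lambda>x. ln (ramanujan_cubic c x)) has_real_derivative
      1 / ramanujan_cubic c x * (24 * x ^ 2 + 8 * x + 1)) (at x)"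
    by (rule DERIV_chain2[where g = "ramanujan_cubic c", OF DERIV_ln_divide[OF pos] P])
  have G: "((\<lambda>x. ln_Gamma (1 + x)) has_real_derivative Digamma (1 + x)) (at x)"
    using assms by (auto intro!: derivative_eq_intros)
  have A: "((\<lambda>x. ln pi / 2 + x * ln x - x) has_real_derivative ln x) (at x)"
    using assms by (auto intro!: derivative_eq_intros)
  from DERIV_diff[OF G DERIV_add[OF A DERIV_cdivide[OF L, of 6]]] show ?thesis
    unfolding ramanujan_gap_def ramanujan_slope_def by (rule DERIV_cong) simp
qed

lemma ramanujan_slope_deriv:
  assumes "c > 0" "x > 0"
  shows "(ramanujan_slope c has_real_derivative ramanujan_curvature c x) (at x)"
proof -
  have P: "(ramanujan_cubic c has_real_derivative 24 * x ^ 2 + 8 * x + 1) (at x)"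
    unfolding ramanujan_cubic_def by (auto intro!: derivative_eq_intros)
  have P': "((\<lambda>x. 24 * x ^ 2 + 8 * x + 1) has_real_derivative 48 * x + 8) (at x)"
    by (auto intro!: derivative_eq_intros)
  have n: "1 + x \<notin> \<int>\<^sub>\<le>\<^sub>0" using assms by auto
  have pos: "ramanujan_cubic c x > 0" using assms by (intro ramanujan_cubic_pos) auto
  have "((\<lambda>x. (24 * x ^ 2 + 8 * x + 1) / (6 * ramanujan_cubic c x)) has_real_derivative
      ((48 * x + 8) * (6 * ramanujan_cubic c x) - (24 * x ^ 2 + 8 * x + 1) * (6 * (24 * x ^ 2 + 8 * x + 1)))
        / (6 * ramanujan_cubic c x * (6 * ramanujan_cubic c x))) (at x)"
    using pos by (intro DERIV_divide P' DERIV_cmult P) auto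
  also have "((48 * x + 8) * (6 * ramanujan_cubic c x) - (24 * x ^ 2 + 8 * x + 1) * (6 * (24 * x ^ 2 + 8 * x + 1)))
        / (6 * ramanujan_cubic c x * (6 * ramanujan_cubic c x)) =
      - (((24 * x ^ 2 + 8 * x + 1) ^ 2 - (48 * x + 8) * ramanujan_cubic c x) / (6 * ramanujan_cubic c x ^ 2))"
    using pos by (simp add: divide_simps) algebra
  finally have Q: "((\<lambda>x. (24 * x ^ 2 + 8 * x + 1) / (6 * ramanujan_cubic c x)) has_real_derivative
      - (((24 * x ^ 2 + 8 * x + 1) ^ 2 - (48 * x + 8) * ramanujan_cubic c x) / (6 * ramanujan_cubic c x ^ 2))) (at x)" .
  have "((\<lambda>x. Digamma (1 + x) - ln x) has_real_derivative Polygamma 1 (1 + x) - 1 / x) (at x)"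
    using assms n by (auto intro!: derivative_eq_intros)
  from DERIV_diff[OF this Q] show ?thesis
    unfolding ramanujan_slope_def ramanujan_curvature_def by (rule DERIV_cong) simp
qed

text \<open>Subtracting \<open>1 / x\<close> at once keeps the degrees low: the leading terms at infinity cancel in the combined
fraction.\<close>

lemma Polygamma_1_minus_inverse_lower:
  fixes x :: real
  assumes "x > 0"
  shows "- (15 * x ^ 4 + 70 * x ^ 3 + 125 * x ^ 2 + 101 * x + 30) / (30 * x * (1 + x) ^ 5)
    \<le> Polygamma 1 (1 + x) - 1 / x"
proof -
  have pos: "1 + x > 0" using assms by simp
  have "1 / (1 + x) + 1 / (2 * (1 + x) ^ 2) + 1 / (6 * (1 + x) ^ 3) - 1 / (30 * (1 + x) ^ 5) - 1 / x
      = - (15 * x ^ 4 + 70 * x ^ 3 + 125 * x ^ 2 + 101 * x + 30) / (30 * x * (1 + x) ^ 5)"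
    using assms pos by (simp add: divide_simps) algebra
  then show ?thesis using Polygamma_1_lower[OF pos] by linarith
qed

text \<open>One step of the recurrence, that is, the bound at \<open>2 + x\<close> instead of \<open>1 + x\<close>, is needed where the
curvature of the gap is itself only of the order of \<open>10^-4\<close>.\<close>

lemma Polygamma_1_minus_inverse_lower_shifted:
  fixes x :: real
  assumes "x > 0"
  shows "- (15 * x ^ 6 + 175 * x ^ 5 + 855 * x ^ 4 + 2246 * x ^ 3 + 3362 * x ^ 2 + 2741 * x + 960)
      / (30 * x * (1 + x) ^ 2 * (2 + x) ^ 5)
    \<le> Polygamma 1 (1 + x) - 1 / x"
proof -
  have pos: "1 + x > 0" "2 + x > 0" using assms by auto
  have "1 / (2 + x) + 1 / (2 * (2 + x) ^ 2) + 1 / (6 * (2 + x) ^ 3) - 1 / (30 * (2 + x) ^ 5)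
        + 1 / (1 + x) ^ 2 - 1 / x
      = - (15 * x ^ 6 + 175 * x ^ 5 + 855 * x ^ 4 + 2246 * x ^ 3 + 3362 * x ^ 2 + 2741 * x + 960)
      / (30 * x * (1 + x) ^ 2 * (2 + x) ^ 5)"
    using assms pos by (simp add: divide_simps) algebra
  moreover have "Polygamma 1 (2 + x) = Polygamma 1 (1 + x) - 1 / (1 + x) ^ 2"
    using Polygamma_plus1[of "1 + x" 1] pos by (simp add: power2_eq_square add_ac)
  ultimately show ?thesis using Polygamma_1_lower[OF pos(2)] by linarith
qed

lemma Polygamma_1_minus_inverse_upper:
  fixes x :: real
  assumes "x > 0"
  shows "Polygamma 1 (1 + x) - 1 / x \<le> - (3 * x ^ 2 + 8 * x + 6) / (6 * x * (1 + x) ^ 3)"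
proof -
  have pos: "1 + x > 0" using assms by simp
  have "1 / (1 + x) + 1 / (2 * (1 + x) ^ 2) + 1 / (6 * (1 + x) ^ 3) - 1 / x
      = - (3 * x ^ 2 + 8 * x + 6) / (6 * x * (1 + x) ^ 3)"
    using assms pos by (simp add: divide_simps) algebra
  moreover have "1 / (42 * (1 + x) ^ 7) \<le> 1 / (30 * (1 + x) ^ 5)"
  proof -
    have "30 * (1 + x) ^ 5 \<le> 42 * (1 + x) ^ 7"
      using assms by (intro mult_mono power_increasing) auto
    then show ?thesis using pos by (intro divide_left_mono) auto
  qed
  ultimately show ?thesis using Polygamma_1_upper[OF pos] by linarith
qed

lemma nonneg_of_scaled:
  fixes m p s :: real
  shows "m * p = s \<Longrightarrow> 0 < m \<Longrightarrow> 0 \<le> s \<Longrightarrow> 0 \<le> p"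
  by (auto simp: zero_le_mult_iff)

lemma fraction_sum_nonneg:
  fixes A B C P :: real
  assumes "0 \<le> 6 * A * P ^ 2 + B * C" "B > 0" "P > 0"
  shows "0 \<le> A / B + C / (6 * P ^ 2)"
proof -
  have "A / B + C / (6 * P ^ 2) = (6 * A * P ^ 2 + B * C) / (6 * B * P ^ 2)"
    using assms by (simp add: field_simps)
  with assms show ?thesis by simp
qed

text \<open>With \<open>- N / B\<close> a bound for the trigamma function minus \<open>1 / x\<close> and \<open>C / (6 P^2)\<close> the remaining part of
\<open>ramanujan_curvature\<close>, a bound for the curvature becomes a polynomial inequality.\<close>

lemma fraction_sum_ge:
  fixes B C N P e :: real
  assumes "0 \<le> 6 * (e * B - N) * P ^ 2 + B * C" "B > 0" "P > 0"
  shows "- e \<le> - N / B + C / (6 * P ^ 2)"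
proof -
  have "e - N / B = (e * B - N) / B" using assms by (simp add: field_simps)
  with fraction_sum_nonneg[OF assms] show ?thesis by simp
qed

lemma fraction_sum_le:
  fixes B C N P e :: real
  assumes "0 \<le> 6 * (e * B + N) * P ^ 2 - B * C" "B > 0" "P > 0"
  shows "- N / B + C / (6 * P ^ 2) \<le> e"
  using fraction_sum_ge[of e B "- N" P "- C"] assms by simp

text \<open>Each of the following five lemmas rests on an identity whose right-hand side is the polynomial in
question, up to a positive factor, in the Bernstein basis of the interval: products of powers of the two
linear functions that vanish at its end points. All the coefficients are positive, hence so is the
polynomial. The first factor merely makes the coefficients integers.

For \<open>c = 1/100\<close> the curvature is nonnegative from \<open>1/200\<close> to \<open>3/4\<close>; it changes sign a little later, and
up to 1 stays above a small negative constant.\<close>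

lemma ramanujan_curvature_lower_left:
  assumes "1 / 200 \<le> x" "x \<le> 3 / 4"
  shows "0 \<le> ramanujan_curvature (1 / 100) x"
proof -
  let ?P = "ramanujan_cubic (1 / 100) x" and ?B = "30 * x * (1 + x) ^ 2 * (2 + x) ^ 5"
    and ?N = "15 * x ^ 6 + 175 * x ^ 5 + 855 * x ^ 4 + 2246 * x ^ 3 + 3362 * x ^ 2 + 2741 * x + 960"
  have x: "x > 0" and pos: "?B > 0" "?P > 0"
    using assms by (auto intro!: ramanujan_cubic_pos)
  have eq: "741321111134621518827520000 / 3 * (6 * (- ?N) * ?P ^ 2
        + ?B * ((24 * x ^ 2 + 8 * x + 1) ^ 2 - (48 * x + 8) * ?P)) =
        44966803458160043114250 * (3 - 4 * x) ^ 9
        + 169646725555058380497000 * (200 * x - 1) * (3 - 4 * x) ^ 8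
        + 40478088587739388415500 * (200 * x - 1) ^ 2 * (3 - 4 * x) ^ 7
        + 4032468514776824353135 * (200 * x - 1) ^ 3 * (3 - 4 * x) ^ 6
        + 212034648229260806730 * (200 * x - 1) ^ 4 * (3 - 4 * x) ^ 5
        + 6383295403974036445 * (200 * x - 1) ^ 5 * (3 - 4 * x) ^ 4
        + 111288114556002896 * (200 * x - 1) ^ 6 * (3 - 4 * x) ^ 3
        + 1063583596119737 * (200 * x - 1) ^ 7 * (3 - 4 * x) ^ 2
        + 4670829650736 * (200 * x - 1) ^ 8 * (3 - 4 * x)
        + 4918148787 * (200 * x - 1) ^ 9"
    unfolding ramanujan_cubic_def by algebra
  have "0 \<le> - ?N / ?B + ((24 * x ^ 2 + 8 * x + 1) ^ 2 - (48 * x + 8) * ?P) / (6 * ?P ^ 2)"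
    by (rule fraction_sum_ge[where e = 0, unfolded mult_zero_left diff_0 minus_zero,
        OF nonneg_of_scaled[OF eq] pos])
      (use assms in \<open>auto intro!: add_nonneg_nonneg mult_nonneg_nonneg zero_le_power\<close>)
  then show ?thesis
    using Polygamma_1_minus_inverse_lower_shifted[OF x]
    unfolding ramanujan_curvature_def by linarith
qed

lemma ramanujan_curvature_lower_right:
  assumes "3 / 4 \<le> x" "x \<le> 1"
  shows "- (17 / 100000) \<le> ramanujan_curvature (1 / 100) x"
proof -
  let ?P = "ramanujan_cubic (1 / 100) x" and ?B = "30 * x * (1 + x) ^ 2 * (2 + x) ^ 5"
    and ?N = "15 * x ^ 6 + 175 * x ^ 5 + 855 * x ^ 4 + 2246 * x ^ 3 + 3362 * x ^ 2 + 2741 * x + 960"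
  have x: "x > 0" and pos: "?B > 0" "?P > 0"
    using assms by (auto intro!: ramanujan_cubic_pos)
  have eq: "50000000 / 3 * (6 * (17 / 100000 * ?B - ?N) * ?P ^ 2
        + ?B * ((24 * x ^ 2 + 8 * x + 1) ^ 2 - (48 * x + 8) * ?P)) =
        5239353705895898112 * (1 - x) ^ 14
        + 16985604443795030016 * (4 * x - 3) * (1 - x) ^ 13
        + 25149383531937224192 * (4 * x - 3) ^ 2 * (1 - x) ^ 12
        + 22474185710731681984 * (4 * x - 3) ^ 3 * (1 - x) ^ 11
        + 13490154677508350016 * (4 * x - 3) ^ 4 * (1 - x) ^ 10
        + 5725436510184083344 * (4 * x - 3) ^ 5 * (1 - x) ^ 9
        + 1760666097987417307 * (4 * x - 3) ^ 6 * (1 - x) ^ 8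
        + 395451209741076844 * (4 * x - 3) ^ 7 * (1 - x) ^ 7
        + 64671626078347263 * (4 * x - 3) ^ 8 * (1 - x) ^ 6
        + 7650903489384012 * (4 * x - 3) ^ 9 * (1 - x) ^ 5
        + 664406007719149 * (4 * x - 3) ^ 10 * (1 - x) ^ 4
        + 46768730361132 * (4 * x - 3) ^ 11 * (1 - x) ^ 3
        + 3175026073989 * (4 * x - 3) ^ 12 * (1 - x) ^ 2
        + 188081315868 * (4 * x - 3) ^ 13 * (1 - x)
        + 5838076772 * (4 * x - 3) ^ 14"
    unfolding ramanujan_cubic_def by algebra
  have "- (17 / 100000) \<le> - ?N / ?B + ((24 * x ^ 2 + 8 * x + 1) ^ 2 - (48 * x + 8) * ?P) / (6 * ?P ^ 2)"
    by (rule fraction_sum_ge[OF nonneg_of_scaled[OF eq] pos])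
      (use assms in \<open>auto intro!: add_nonneg_nonneg mult_nonneg_nonneg zero_le_power\<close>)
  then show ?thesis
    using Polygamma_1_minus_inverse_lower_shifted[OF x]
    unfolding ramanujan_curvature_def by linarith
qed

text \<open>For \<open>c = 1/30\<close> the curvature is negative near 0, changes sign between \<open>1/50\<close> and \<open>1/48\<close> and once more
between \<open>1/6\<close> and \<open>1/5\<close>. The first two intervals overrun these zeros by a little, which is
why the bounds there are 1 and \<open>-1/10\<close> instead of 0.\<close>

lemma ramanujan_curvature_upper_left:
  assumes "0 < x" "x \<le> 1 / 48"
  shows "ramanujan_curvature (1 / 30) x \<le> 1"
proof -
  let ?P = "ramanujan_cubic (1 / 30) x" and ?B = "6 * x * (1 + x) ^ 3"
    and ?N = "3 * x ^ 2 + 8 * x + 6"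
  have x: "x > 0" and pos: "?B > 0" "?P > 0"
    using assms by (auto intro!: ramanujan_cubic_pos)
  have eq: "150 * (6 * (?B + ?N) * ?P ^ 2
        - ?B * ((24 * x ^ 2 + 8 * x + 1) ^ 2 - (48 * x + 8) * ?P)) =
        6 * (1 - 48 * x) ^ 10
        + 2594 * x * (1 - 48 * x) ^ 9
        + 498489 * x ^ 2 * (1 - 48 * x) ^ 8
        + 55904538 * x ^ 3 * (1 - 48 * x) ^ 7
        + 4034438478 * x ^ 4 * (1 - 48 * x) ^ 6
        + 194491263312 * x ^ 5 * (1 - 48 * x) ^ 5
        + 6276039024312 * x ^ 6 * (1 - 48 * x) ^ 4
        + 131337229508352 * x ^ 7 * (1 - 48 * x) ^ 3
        + 1639439014881024 * x ^ 8 * (1 - 48 * x) ^ 2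
        + 9886141330274304 * x ^ 9 * (1 - 48 * x)
        + 11700382155720192 * x ^ 10"
    unfolding ramanujan_cubic_def by algebra
  have "- ?N / ?B + ((24 * x ^ 2 + 8 * x + 1) ^ 2 - (48 * x + 8) * ?P) / (6 * ?P ^ 2) \<le> 1"
    by (rule fraction_sum_le[where e = 1, unfolded mult_1, OF nonneg_of_scaled[OF eq] pos])
      (use assms in \<open>auto intro!: add_nonneg_nonneg mult_nonneg_nonneg zero_le_power\<close>)
  then show ?thesis
    using Polygamma_1_minus_inverse_upper[OF x]
    unfolding ramanujan_curvature_def by linarith
qed

lemma ramanujan_curvature_upper_middle:
  assumes "1 / 48 \<le> x" "x \<le> 1 / 5"
  shows "- (1 / 10) \<le> ramanujan_curvature (1 / 30) x"
proof -
  let ?P = "ramanujan_cubic (1 / 30) x" and ?B = "30 * x * (1 + x) ^ 5"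
    and ?N = "15 * x ^ 4 + 70 * x ^ 3 + 125 * x ^ 2 + 101 * x + 30"
  have x: "x > 0" and pos: "?B > 0" "?P > 0"
    using assms by (auto intro!: ramanujan_cubic_pos)
  have eq: "5993944619589386460150 * (6 * (1 / 10 * ?B - ?N) * ?P ^ 2
        + ?B * ((24 * x ^ 2 + 8 * x + 1) ^ 2 - (48 * x + 8) * ?P)) =
        172244029586994660096 * (1 - 5 * x) ^ 12
        + 4610201814167823945216 * (48 * x - 1) * (1 - 5 * x) ^ 11
        + 5318092516141432725120 * (48 * x - 1) ^ 2 * (1 - 5 * x) ^ 10
        + 2794243012259378889600 * (48 * x - 1) ^ 3 * (1 - 5 * x) ^ 9
        + 870516698498845788060 * (48 * x - 1) ^ 4 * (1 - 5 * x) ^ 8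
        + 177852121617296590272 * (48 * x - 1) ^ 5 * (1 - 5 * x) ^ 7
        + 24936315829208996847 * (48 * x - 1) ^ 6 * (1 - 5 * x) ^ 6
        + 2440170953956820325 * (48 * x - 1) ^ 7 * (1 - 5 * x) ^ 5
        + 166094865565231215 * (48 * x - 1) ^ 8 * (1 - 5 * x) ^ 4
        + 7686264443465830 * (48 * x - 1) ^ 9 * (1 - 5 * x) ^ 3
        + 230464501748575 * (48 * x - 1) ^ 10 * (1 - 5 * x) ^ 2
        + 4074957986875 * (48 * x - 1) ^ 11 * (1 - 5 * x)
        + 33431256175 * (48 * x - 1) ^ 12"
    unfolding ramanujan_cubic_def by algebra
  have "- (1 / 10) \<le> - ?N / ?B + ((24 * x ^ 2 + 8 * x + 1) ^ 2 - (48 * x + 8) * ?P) / (6 * ?P ^ 2)"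
    by (rule fraction_sum_ge[OF nonneg_of_scaled[OF eq] pos])
      (use assms in \<open>auto intro!: add_nonneg_nonneg mult_nonneg_nonneg zero_le_power\<close>)
  then show ?thesis
    using Polygamma_1_minus_inverse_lower[OF x]
    unfolding ramanujan_curvature_def by linarith
qed

lemma ramanujan_curvature_upper_right:
  assumes "1 / 5 \<le> x" "x \<le> 1"
  shows "ramanujan_curvature (1 / 30) x \<le> 0"
proof -
  let ?P = "ramanujan_cubic (1 / 30) x" and ?B = "6 * x * (1 + x) ^ 3"
    and ?N = "3 * x ^ 2 + 8 * x + 6"
  have x: "x > 0" and pos: "?B > 0" "?P > 0"
    using assms by (auto intro!: ramanujan_cubic_pos)
  have eq: "153600 * (6 * (?N) * ?P ^ 2
        - ?B * ((24 * x ^ 2 + 8 * x + 1) ^ 2 - (48 * x + 8) * ?P)) =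
        46205 * (1 - x) ^ 5
        + 499845 * (5 * x - 1) * (1 - x) ^ 4
        + 973570 * (5 * x - 1) ^ 2 * (1 - x) ^ 3
        + 688138 * (5 * x - 1) ^ 3 * (1 - x) ^ 2
        + 187569 * (5 * x - 1) ^ 4 * (1 - x)
        + 13217 * (5 * x - 1) ^ 5"
    unfolding ramanujan_cubic_def by algebra
  have "- ?N / ?B + ((24 * x ^ 2 + 8 * x + 1) ^ 2 - (48 * x + 8) * ?P) / (6 * ?P ^ 2) \<le> 0"
    by (rule fraction_sum_le[where e = 0, unfolded mult_zero_left add_0_left, OF nonneg_of_scaled[OF eq] pos])
      (use assms in \<open>auto intro!: add_nonneg_nonneg mult_nonneg_nonneg zero_le_power\<close>)
  then show ?thesis
    using Polygamma_1_minus_inverse_upper[OF x]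
    unfolding ramanujan_curvature_def by linarith
qed

section \<open>Numerical values of the gap and its slope\<close>

lemma ln_prime_bounds:
  "0.6931471804 \<le> ln (2::real)" "ln (2::real) \<le> 0.6931471807"
  "1.0986122883 \<le> ln (3::real)" "ln (3::real) \<le> 1.0986122891"
  "1.6094379120 \<le> ln (5::real)" "ln (5::real) \<le> 1.6094379129"
  "1.9459101485 \<le> ln (7::real)" "ln (7::real) \<le> 1.9459101498"
proof -
  have l2: "0.6931471804 \<le> ln (2::real)" "ln (2::real) \<le> 0.6931471807"
    using ln_approx_bounds[of 2 9] by (simp_all add: eval_nat_numeral)
  have l32: "0.4054651079 \<le> ln (3 / 2 :: real)" "ln (3 / 2 :: real) \<le> 0.4054651083"
    using ln_approx_bounds[of "3/2" 6] by (simp_all add: eval_nat_numeral)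
  have l54: "0.2231435512 \<le> ln (5 / 4 :: real)" "ln (5 / 4 :: real) \<le> 0.2231435514"
    using ln_approx_bounds[of "5/4" 5] by (simp_all add: eval_nat_numeral)
  have l76: "0.1541506798 \<le> ln (7 / 6 :: real)" "ln (7 / 6 :: real) \<le> 0.1541506799"
    using ln_approx_bounds[of "7/6" 5] by (simp_all add: eval_nat_numeral)
  have l3: "ln 3 = ln 2 + ln (3 / 2 :: real)" by (simp add: ln_div)
  have l5: "ln 5 = 2 * ln 2 + ln (5 / 4 :: real)"
    using ln_realpow[of 2 2] by (simp add: ln_div)
  have l7: "ln 7 = ln 2 + ln 3 + ln (7 / 6 :: real)"
    using ln_mult[of "2::real" 3] by (simp add: ln_div)
  show "0.6931471804 \<le> ln (2::real)" "ln (2::real) \<le> 0.6931471807" by (fact l2)+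
  show "1.0986122883 \<le> ln (3::real)" "ln (3::real) \<le> 1.0986122891"
    unfolding l3 using l2 l32 by simp_all
  show "1.6094379120 \<le> ln (5::real)" "ln (5::real) \<le> 1.6094379129"
    unfolding l5 using l2 l54 by simp_all
  show "1.9459101485 \<le> ln (7::real)" "ln (7::real) \<le> 1.9459101498"
    unfolding l7 l3 using l2 l32 l76 by simp_all
qed

text \<open>Logarithms of rational numbers are computed from a nearby rational number with prime factors at most 7
and a quotient close to 1, for whose logarithm one or two terms of the series suffice.\<close>

lemma ln_7_smooth:
  "ln (2 ^ a * 3 ^ b * 5 ^ c * 7 ^ d) =
    real a * ln 2 + real b * ln 3 + real c * ln 5 + real d * ln (7::real)"
  by (simp add: ln_mult ln_realpow)

lemma ln_Gamma_plus1_real: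
  fixes x :: real
  assumes "x > 0"
  shows "ln_Gamma (x + 1) = ln_Gamma x + ln x"
proof -
  have "x \<notin> \<int>\<^sub>\<le>\<^sub>0" using assms by auto
  then have "Gamma (x + 1) = x * Gamma x" by (rule Gamma_plus1)
  moreover have "Gamma x \<noteq> 0" using Gamma_real_pos[OF assms] by linarith
  ultimately show ?thesis using assms by (simp add: ln_Gamma_real_pos ln_mult)
qed

text \<open>The true value is about \<open>1.52/10^6\<close>. Stirling's series is applied at \<open>187/40 = 4 + 27/40\<close>, three steps of the
recurrence further: at \<open>147/40\<close> the lower bound would lose more than \<open>10^-6\<close>.\<close>

lemma ramanujan_gap_lower_at_27_40: "ramanujan_gap (1 / 100) (27 / 40) \<ge> 1.1 / 10 ^ 6"
proof -
  have "ln_Gamma (187 / 40) = ln_Gamma (1 + 27 / 40) + ln (67 / 40) + ln (107 / 40) + ln (147 / 40 :: real)"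
    using ln_Gamma_plus1_real[of "67 / 40"] ln_Gamma_plus1_real[of "107 / 40"]
      ln_Gamma_plus1_real[of "147 / 40"] by simp
  also have "\<dots> = ln_Gamma (1 + 27 / 40) + ln (1053843 / 64000 :: real)"
    using ln_mult[of "67 / 40" "107 / 40 :: real"] ln_mult[of "7169 / 1600" "147 / 40 :: real"] by simp
  finally have shift: "ln_Gamma (1 + 27 / 40) = ln_Gamma (187 / 40) - ln (1053843 / 64000 :: real)"
    by simp
  have a: "ln (187 / 40 :: real) = 3 * ln 3 + ln 7 - 3 * ln 2 - ln 5 - ln (189 / 187)"
    using ln_7_smooth[of 0 3 0 1] ln_7_smooth[of 3 0 1 0] by (simp add: ln_div)
  have b: "ln (1053843 / 64000 :: real) = ln 3 + 2 * ln 5 + ln 7 - 5 * ln 2 + ln (50183 / 50000)"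
    using ln_mult[of "50183 / 50000 :: real" "525 / 32"] ln_7_smooth[of 0 1 2 1] ln_7_smooth[of 5 0 0 0]
    by (simp add: ln_div)
  have c: "ln (39743 / 8000 :: real) = 4 * ln 3 + 2 * ln 7 - 5 * ln 2 - 2 * ln 5 + ln (39743 / 39690)"
    using ln_7_smooth[of 1 4 1 2] ln_7_smooth[of 6 0 3 0] by (simp add: ln_div)
  have d: "ln (27 / 40 :: real) = 3 * ln 3 - 3 * ln 2 - ln 5"
    using ln_7_smooth[of 0 3 0 0] ln_7_smooth[of 3 0 1 0] by (simp add: ln_div)
  have n: "0.0106383982 \<le> ln (189 / 187 :: real)" "ln (189 / 187 :: real) \<le> 0.0106383983"
    "0.0036533184 \<le> ln (50183 / 50000 :: real)" "ln (50183 / 50000 :: real) \<le> 0.0036533185"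
    "0.0013344581 \<le> ln (39743 / 39690 :: real)" "ln (39743 / 39690 :: real) \<le> 0.0013344582"
    using ln_approx_bounds[of "189 / 187" 2] ln_approx_bounds[of "50183 / 50000" 2]
      ln_approx_bounds[of "39743 / 39690" 2] by (simp_all add: eval_nat_numeral)
  have P: "ramanujan_cubic (1 / 100) (27 / 40) = 39743 / 8000"
    by (simp add: ramanujan_cubic_def power_divide)
  then show ?thesis
    using ln_Gamma_lower[of "187 / 40"] ln_prime_bounds n
    unfolding ramanujan_gap_def shift
    by (simp add: P a b c d ln_mult power_divide field_simps)
qed

lemma ramanujan_slope_at_27_40: "ramanujan_slope (1 / 100) (27 / 40) \<in> {- 2 / 10 ^ 6..0}"
proof -
  have "Digamma (187 / 40 :: real) = Digamma (1 + 27 / 40) + 40 / 67 + 40 / 107 + 40 / 147"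
    using Digamma_plus1[of "67 / 40 :: real"] Digamma_plus1[of "107 / 40 :: real"]
      Digamma_plus1[of "147 / 40 :: real"] by simp
  then have shift: "Digamma (1 + 27 / 40) = Digamma (187 / 40) - (40 / 67 + 40 / 107 + 40 / 147 :: real)"
    by simp
  have a: "ln (187 / 40 :: real) = 3 * ln 3 + ln 7 - 3 * ln 2 - ln 5 - ln (189 / 187)"
    using ln_7_smooth[of 0 3 0 1] ln_7_smooth[of 3 0 1 0] by (simp add: ln_div)
  have d: "ln (27 / 40 :: real) = 3 * ln 3 - 3 * ln 2 - ln 5"
    using ln_7_smooth[of 0 3 0 0] ln_7_smooth[of 3 0 1 0] by (simp add: ln_div)
  have n: "0.0106383982 \<le> ln (189 / 187 :: real)" "ln (189 / 187 :: real) \<le> 0.0106383983"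
    using ln_approx_bounds[of "189 / 187" 2] by (simp_all add: eval_nat_numeral)
  have P: "ramanujan_cubic (1 / 100) (27 / 40) = 39743 / 8000"
    by (simp add: ramanujan_cubic_def power_divide)
  then show ?thesis
    using Digamma_lower[of "187 / 40"] Digamma_upper[of "187 / 40"] ln_prime_bounds n
    unfolding ramanujan_slope_def shift
    by (simp add: P a d power_divide)
qed

text \<open>With the argument shifted to \<open>15/4\<close>, the two logarithms differ by exactly \<open>ln 5\<close>.\<close>

lemma ramanujan_slope_lower_at_3_4: "ramanujan_slope (1 / 100) (3 / 4) \<ge> 4 / 10 ^ 5"
proof -
  have "Digamma (15 / 4 :: real) = Digamma (1 + 3 / 4) + 4 / 7 + 4 / 11"
    using Digamma_plus1[of "7 / 4 :: real"] Digamma_plus1[of "11 / 4 :: real"] by simp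
  then have shift: "Digamma (1 + 3 / 4) = Digamma (15 / 4) - (4 / 7 + 4 / 11 :: real)"
    by simp
  have a: "ln (15 / 4 :: real) = ln (3 / 4) + ln 5"
    using ln_mult[of "3 / 4 :: real" 5] by simp
  have P: "ramanujan_cubic (1 / 100) (3 / 4) = 1277 / 200"
    by (simp add: ramanujan_cubic_def power_divide)
  then show ?thesis
    using Digamma_lower[of "15 / 4"] ln_prime_bounds
    unfolding ramanujan_slope_def shift
    by (simp add: P a power_divide)
qed

lemma ramanujan_gap_upper_at_1: "ramanujan_gap (1 / 30) 1 < 0"
proof -
  have a: "ln (391 / 30 :: real) = 2 * ln 2 + 2 * ln 7 - ln 3 - ln 5 - ln (392 / 391)"
    using ln_7_smooth[of 3 0 0 2] ln_7_smooth[of 1 1 1 0] by (simp add: ln_div)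
  have n: "0 \<le> ln (392 / 391 :: real)" "ln (392 / 391 :: real) \<le> 0.0025543"
    using ln_approx_bounds[of "392 / 391" 1] by (simp_all add: eval_nat_numeral)
  have P: "ramanujan_cubic (1 / 30) 1 = 391 / 30"
    by (simp add: ramanujan_cubic_def)
  then show ?thesis
    using ln_Gamma_upper[of 2] ln_prime_bounds n
    unfolding ramanujan_gap_def
    by (simp add: P a ln_mult field_simps)
qed

lemma ramanujan_slope_lower_at_1: "ramanujan_slope (1 / 30) 1 > 0"
proof -
  have P: "ramanujan_cubic (1 / 30) 1 = 391 / 30"
    by (simp add: ramanujan_cubic_def)
  then show ?thesis
    using Digamma_lower[of 2] ln_prime_bounds
    unfolding ramanujan_slope_def by (simp add: P)
qed

lemma ramanujan_gap_upper_at_1_125: "ramanujan_gap (1 / 30) (1 / 125) \<le> - 3 / 10 ^ 4"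
proof -
  have "ln_Gamma (251 / 125) = ln_Gamma (1 + 1 / 125) + ln (126 / 125 :: real)"
    using ln_Gamma_plus1_real[of "126 / 125"] by simp
  then have shift: "ln_Gamma (1 + 1 / 125) = ln_Gamma (251 / 125) - ln (126 / 125 :: real)" by simp
  have a: "ln (251 / 125 :: real) = ln 2 + ln (251 / 250)"
    using ln_mult[of 2 "251 / 250 :: real"] by simp
  have b: "ln (126 / 125 :: real) = ln 2 + 2 * ln 3 + ln 7 - 3 * ln 5"
    using ln_7_smooth[of 1 2 0 1] ln_7_smooth[of 0 0 3 0] by (simp add: ln_div)
  have c: "ln (487423 / 11718750 :: real) = 3 * ln 2 + 4 * ln 3 - 6 * ln 5 + ln (487423 / 486000)"
    using ln_7_smooth[of 4 5 3 0] ln_7_smooth[of 1 1 9 0] by (simp add: ln_div)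
  have d: "ln (1 / 125 :: real) = - 3 * ln 5"
    using ln_7_smooth[of 0 0 3 0] by (simp add: ln_div)
  have n: "0.003992 \<le> ln (251 / 250 :: real)" "ln (251 / 250 :: real) \<le> 0.0039921"
    "0.0029237 \<le> ln (487423 / 486000 :: real)" "ln (487423 / 486000 :: real) \<le> 0.002924"
    using ln_approx_bounds[of "251 / 250" 1] ln_approx_bounds[of "487423 / 486000" 1]
    by (simp_all add: eval_nat_numeral)
  have P: "ramanujan_cubic (1 / 30) (1 / 125) = 487423 / 11718750"
    by (simp add: ramanujan_cubic_def power_divide)
  then show ?thesis
    using ln_Gamma_upper[of "251 / 125"] ln_prime_bounds n
    unfolding ramanujan_gap_def shift
    by (simp add: P a b c d ln_mult power_divide field_simps)
qed

lemma ramanujan_slope_at_1_125: "ramanujan_slope (1 / 30) (1 / 125) \<in> {- 8 / 10 ^ 3..0}"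
proof -
  have b: "ln (126 / 125 :: real) = ln 2 + 2 * ln 3 + ln 7 - 3 * ln 5"
    using ln_7_smooth[of 1 2 0 1] ln_7_smooth[of 0 0 3 0] by (simp add: ln_div)
  have d: "ln (1 / 125 :: real) = - 3 * ln 5"
    using ln_7_smooth[of 0 0 3 0] by (simp add: ln_div)
  have P: "ramanujan_cubic (1 / 30) (1 / 125) = 487423 / 11718750"
    by (simp add: ramanujan_cubic_def power_divide)
  then show ?thesis
    using Digamma_lower[of "126 / 125"] Digamma_upper[of "126 / 125"] ln_prime_bounds
    unfolding ramanujan_slope_def
    by (simp add: P b d power_divide)
qed

lemma ramanujan_gap_upper_at_1_48: "ramanujan_gap (1 / 30) (1 / 48) \<le> - 17 / 10 ^ 4"
proof -
  have b: "ln (49 / 48 :: real) = 2 * ln 7 - 4 * ln 2 - ln 3"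
    using ln_7_smooth[of 0 0 0 2] ln_7_smooth[of 4 1 0 0] by (simp add: ln_div)
  have c: "ln (3869 / 69120 :: real) = 2 * ln 3 - 5 * ln 2 - ln 5 - ln (3888 / 3869)"
    using ln_7_smooth[of 4 5 0 0] ln_7_smooth[of 9 3 1 0] by (simp add: ln_div)
  have d: "ln (1 / 48 :: real) = - 4 * ln 2 - ln 3"
    using ln_7_smooth[of 4 1 0 0] by (simp add: ln_div)
  have n: "0 \<le> ln (3888 / 3869 :: real)" "ln (3888 / 3869 :: real) \<le> 0.0049"
    using ln_approx_bounds[of "3888 / 3869" 1] by (simp_all add: eval_nat_numeral)
  have P: "ramanujan_cubic (1 / 30) (1 / 48) = 3869 / 69120"
    by (simp add: ramanujan_cubic_def power_divide)
  then show ?thesis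
    using ln_Gamma_upper[of "49 / 48"] ln_prime_bounds n
    unfolding ramanujan_gap_def
    by (simp add: P b c d ln_mult power_divide field_simps)
qed

lemma ramanujan_gap_upper_at_1_5: "ramanujan_gap (1 / 30) (1 / 5) \<le> - 5 / 10 ^ 3"
proof -
  have b: "ln (6 / 5 :: real) = ln 2 + ln 3 - ln 5"
    using ln_7_smooth[of 1 1 0 0] by (simp add: ln_div)
  have c: "ln (343 / 750 :: real) = 3 * ln 7 - ln 2 - ln 3 - 3 * ln 5"
    using ln_7_smooth[of 0 0 0 3] ln_7_smooth[of 1 1 3 0] by (simp add: ln_div)
  have d: "ln (1 / 5 :: real) = - ln 5"
    by (simp add: ln_div)
  have P: "ramanujan_cubic (1 / 30) (1 / 5) = 343 / 750"
    by (simp add: ramanujan_cubic_def power_divide)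
  then show ?thesis
    using ln_Gamma_upper[of "6 / 5"] ln_prime_bounds
    unfolding ramanujan_gap_def
    by (simp add: P b c d ln_mult power_divide field_simps)
qed

section \<open>Ramanujan's inequality between 0 and 1\<close>

lemma taylor_quadratic_lower:
  fixes f f' f'' :: "real \<Rightarrow> real"
  assumes "convex C"
    and f': "\<And>x. x \<in> C \<Longrightarrow> (f has_real_derivative f' x) (at x)"
    and f'': "\<And>x. x \<in> C \<Longrightarrow> (f' has_real_derivative f'' x) (at x)"
    and bound: "\<And>x. x \<in> C \<Longrightarrow> m \<le> f'' x"
    and "x \<in> C" "y \<in> C"
  shows "f x + f' x * (y - x) + m / 2 * (y - x)\<^sup>2 \<le> f y"
proof -
  have "(f' x - m * x) * (y - x) \<le> (f y - m / 2 * y\<^sup>2) - (f x - m / 2 * x\<^sup>2)"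
  proof (rule f''_imp_f'[of C "\<lambda>x. f x - m / 2 * x\<^sup>2" "\<lambda>x. f' x - m * x" "\<lambda>x. f'' x - m"])
    fix x assume "x \<in> C"
    show "((\<lambda>x. f x - m / 2 * x\<^sup>2) has_real_derivative f' x - m * x) (at x)"
      by (rule DERIV_diff[OF f'[OF \<open>x \<in> C\<close>]]) (auto intro!: derivative_eq_intros)
    show "((\<lambda>x. f' x - m * x) has_real_derivative f'' x - m) (at x)"
      by (rule DERIV_diff[OF f''[OF \<open>x \<in> C\<close>]]) (auto intro!: derivative_eq_intros)
    show "0 \<le> f'' x - m" using bound[OF \<open>x \<in> C\<close>] by simp
  qed (use assms in auto)
  then show ?thesis by (simp add: power2_eq_square algebra_simps)
qed

lemma taylor_quadratic_upper:
  fixes f f' f'' :: "real \<Rightarrow> real"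
  assumes "convex C"
    and f': "\<And>x. x \<in> C \<Longrightarrow> (f has_real_derivative f' x) (at x)"
    and f'': "\<And>x. x \<in> C \<Longrightarrow> (f' has_real_derivative f'' x) (at x)"
    and bound: "\<And>x. x \<in> C \<Longrightarrow> f'' x \<le> m"
    and "x \<in> C" "y \<in> C"
  shows "f y \<le> f x + f' x * (y - x) + m / 2 * (y - x)\<^sup>2"
proof -
  have "- f x + - f' x * (y - x) + - m / 2 * (y - x)\<^sup>2 \<le> - f y"
    by (rule taylor_quadratic_lower[of C "\<lambda>x. - f x" "\<lambda>x. - f' x" "\<lambda>x. - f'' x"])
      (use assms in \<open>auto intro: DERIV_minus\<close>)
  then show ?thesis by simp
qed

text \<open>Close to 0 the gap is far from its minimum: \<open>pi^3 P < 1\<close> for the cubic \<open>P\<close> there, even with \<open>pi < 4\<close>, and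
\<open>ln_Gamma (1 + x) \<ge> - 6/10 x\<close> because the digamma function increases from \<open>- euler_mascheroni\<close> at 1.\<close>

lemma ramanujan_gap_pos_near_0:
  assumes "0 < x" "x \<le> 1 / 200"
  shows "ramanujan_gap (1 / 100) x > 0"
proof -
  have "ln_Gamma 1 + - (6 / 10) * x \<le> ln_Gamma (1 + x)"
  proof -
    have "\<exists>t. t > 1 \<and> t < 1 + x \<and> ln_Gamma (1 + x) - ln_Gamma 1 = (1 + x - 1) * Digamma t"
      by (rule MVT2) (use assms in \<open>auto intro!: derivative_eq_intros\<close>)
    then obtain t where t: "t > 1" "t < 1 + x" "ln_Gamma (1 + x) - ln_Gamma 1 = x * Digamma t"
      by auto
    have "- (6 / 10) \<le> Digamma (1 :: real)" using euler_mascheroni_less_13_over_22 by simp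
    also have "\<dots> \<le> Digamma t" using t by (intro Digamma_real_mono) auto
    finally have "x * (- (6 / 10)) \<le> x * Digamma t" using assms by (intro mult_left_mono) auto
    with t show ?thesis by simp
  qed
  moreover have "x * ln x \<le> 0" using assms by (simp add: mult_nonneg_nonpos)
  moreover have "3 * ln pi + ln (ramanujan_cubic (1 / 100) x) < 0"
  proof -
    have "8 * x ^ 3 + 4 * x ^ 2 \<le> 8 * (1 / 200) ^ 3 + 4 * (1 / 200) ^ 2"
      using assms by (intro add_mono mult_left_mono power_mono) auto
    then have P: "ramanujan_cubic (1 / 100) x < 1 / 64" "ramanujan_cubic (1 / 100) x > 0"
      using assms ramanujan_cubic_pos[of "1 / 100" x] by (auto simp: ramanujan_cubic_def power_divide)
    have "ln pi < ln 4" using pi_less_4 by simp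
    moreover have "ln (ramanujan_cubic (1 / 100) x) < ln (1 / 64)"
      using P by simp
    moreover have "ln (1 / 64 :: real) = - 3 * ln 4"
      using ln_realpow[of 4 3] by (simp add: ln_div)
    ultimately show ?thesis by linarith
  qed
  moreover have "ln_Gamma (1 :: real) = 0" by (simp add: ln_Gamma_real_pos)
  ultimately show ?thesis using assms unfolding ramanujan_gap_def by (simp add: field_simps)
qed

text \<open>The gap is convex on \<open>[1/200, 3/4]\<close> and minimal very near \<open>27/40\<close>, so there it lies above its tangent
at \<open>27/40\<close>, which is positive as the slope is almost 0. On \<open>[3/4, 1]\<close> the slope at \<open>3/4\<close> outweighs the
possible negative curvature.\<close>

lemma ramanujan_gap_pos:
  assumes "0 < x" "x \<le> 1"
  shows "ramanujan_gap (1 / 100) x > 0"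
proof -
  note d = ramanujan_gap_deriv[of "1 / 100"] ramanujan_slope_deriv[of "1 / 100"]
  have left: "ramanujan_gap (1 / 100) x > 0" if "x \<in> {1 / 200..3 / 4}" for x
  proof -
    have "ramanujan_gap (1 / 100) (27 / 40) + ramanujan_slope (1 / 100) (27 / 40) * (x - 27 / 40)
        + 0 / 2 * (x - 27 / 40)\<^sup>2 \<le> ramanujan_gap (1 / 100) x"
      by (rule taylor_quadratic_lower[of "{1 / 200..3 / 4}" _ _ "ramanujan_curvature (1 / 100)"])
        (use that in \<open>auto intro!: d ramanujan_curvature_lower_left\<close>)
    moreover have "ramanujan_slope (1 / 100) (27 / 40) * (x - 27 / 40) \<ge> - 2 / 10 ^ 7"
    proof (cases "x \<le> 27 / 40")
      case True
      then have "ramanujan_slope (1 / 100) (27 / 40) * (x - 27 / 40) \<ge> 0"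
        using ramanujan_slope_at_27_40 by (intro mult_nonpos_nonpos) auto
      then show ?thesis by simp
    next
      case False
      then have "(- 2 / 10 ^ 6) * (x - 27 / 40) \<le> ramanujan_slope (1 / 100) (27 / 40) * (x - 27 / 40)"
        using ramanujan_slope_at_27_40 by (intro mult_right_mono) auto
      moreover have "- 2 / 10 ^ 7 \<le> (- 2 / 10 ^ 6) * (x - 27 / 40)" using that by simp
      ultimately show ?thesis by linarith
    qed
    ultimately show ?thesis using ramanujan_gap_lower_at_27_40 by simp
  qed
  consider "x < 1 / 200" | "1 / 200 \<le> x" "x \<le> 3 / 4" | "3 / 4 < x" by linarith
  then show ?thesis
  proof cases
    case 1
    then show ?thesis using assms by (intro ramanujan_gap_pos_near_0) auto
  next
    case 2
    then show ?thesis by (intro left) auto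
  next
    case 3
    have taylor: "ramanujan_gap (1 / 100) (3 / 4) + ramanujan_slope (1 / 100) (3 / 4) * (x - 3 / 4)
        + (- (17 / 100000)) / 2 * (x - 3 / 4)\<^sup>2 \<le> ramanujan_gap (1 / 100) x"
      by (rule taylor_quadratic_lower[of "{3 / 4..1}" _ _ "ramanujan_curvature (1 / 100)"])
        (use 3 assms in \<open>auto intro!: d ramanujan_curvature_lower_right\<close>)
    have slope: "1 / 25000 * (x - 3 / 4) \<le> ramanujan_slope (1 / 100) (3 / 4) * (x - 3 / 4)"
      using 3 ramanujan_slope_lower_at_3_4 by (intro mult_right_mono) auto
    have "(x - 3 / 4)\<^sup>2 \<le> 1 / 4 * (x - 3 / 4)"
      using 3 assms unfolding power2_eq_square by (intro mult_right_mono) auto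
    then have square: "- (1 / 40000) * (x - 3 / 4) \<le> (- (17 / 100000)) / 2 * (x - 3 / 4)\<^sup>2"
      using 3 by simp
    have "0 < ramanujan_gap (1 / 100) (3 / 4)" by (rule left) simp
    also have "\<dots> \<le> ramanujan_gap (1 / 100) (3 / 4) + (1 / 25000 * (x - 3 / 4) + - (1 / 40000) * (x - 3 / 4))"
      using 3 by simp
    also have "\<dots> \<le> ramanujan_gap (1 / 100) (3 / 4) + (ramanujan_slope (1 / 100) (3 / 4) * (x - 3 / 4)
        + (- (17 / 100000)) / 2 * (x - 3 / 4)\<^sup>2)"
      by (intro add_left_mono add_mono slope square)
    also have "\<dots> \<le> ramanujan_gap (1 / 100) x" using taylor by (simp only: add.assoc)
    finally show ?thesis .
  qed
qed

text \<open>The gap has a local maximum close to \<open>1/125\<close>, where it is about \<open>-3.3/10^4\<close>; a parabola through this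
point bounds it on \<open>(0, 1/48]\<close>. On \<open>[1/48, 1/5]\<close> it is convex up to a small quadratic term, hence bounded by the
larger of its end values plus that term. On \<open>[1/5, 1]\<close> it is concave, and its tangent at 1 has positive
slope and negative value.\<close>

lemma ramanujan_gap_neg:
  assumes "0 < x" "x \<le> 1"
  shows "ramanujan_gap (1 / 30) x < 0"
proof -
  note d = ramanujan_gap_deriv[of "1 / 30"] ramanujan_slope_deriv[of "1 / 30"]
  consider "x < 1 / 48" | "1 / 48 \<le> x" "x \<le> 1 / 5" | "1 / 5 < x" by linarith
  then show ?thesis
  proof cases
    case 1
    let ?s = "ramanujan_slope (1 / 30) (1 / 125)"
    have "ramanujan_gap (1 / 30) x \<le> ramanujan_gap (1 / 30) (1 / 125) + ?s * (x - 1 / 125)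
        + 1 / 2 * (x - 1 / 125)\<^sup>2"
      by (rule taylor_quadratic_upper[of "{0<..1 / 48}" _ _ "ramanujan_curvature (1 / 30)"])
        (use 1 assms in \<open>auto intro!: d ramanujan_curvature_upper_left\<close>)
    moreover have "?s * (x - 1 / 125) \<le> 64 / 10 ^ 6"
    proof -
      have "- ?s * (1 / 125 - x) \<le> - ?s * (1 / 125)"
        using ramanujan_slope_at_1_125 assms by (intro mult_left_mono) auto
      then show ?thesis using ramanujan_slope_at_1_125 by (simp add: algebra_simps)
    qed
    moreover have "(x - 1 / 125)\<^sup>2 \<le> (13 / 1000)\<^sup>2"
    proof (rule power2_le_iff_abs_le[THEN iffD2])
      show "\<bar>x - 1 / 125\<bar> \<le> 13 / 1000" using 1 assms by linarith
    qed simp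
    ultimately show ?thesis using ramanujan_gap_upper_at_1_125 by (simp add: power_divide)
  next
    case 2
    have lower: "ramanujan_gap (1 / 30) x + ramanujan_slope (1 / 30) x * (y - x)
        + (- (1 / 10)) / 2 * (y - x)\<^sup>2 \<le> ramanujan_gap (1 / 30) y" if "y \<in> {1 / 48..1 / 5}" for y
      by (rule taylor_quadratic_lower[of "{1 / 48..1 / 5}" _ _ "ramanujan_curvature (1 / 30)"])
        (use 2 that in \<open>auto intro!: d ramanujan_curvature_upper_middle\<close>)
    have square: "(y - x)\<^sup>2 \<le> (9 / 50)\<^sup>2" if "y \<in> {1 / 48..1 / 5}" for y
    proof (rule power2_le_iff_abs_le[THEN iffD2])
      have "1 / 48 \<le> y" "y \<le> 1 / 5" using that by auto
      with 2 show "\<bar>y - x\<bar> \<le> 9 / 50" by linarith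
    qed simp
    \<comment> \<open>Compare with the end point that lies in the direction of ascent.\<close>
    show ?thesis
    proof (cases "ramanujan_slope (1 / 30) x \<ge> 0")
      case True
      then have "ramanujan_slope (1 / 30) x * (1 / 5 - x) \<ge> 0" using 2 by simp
      then show ?thesis
        using lower[of "1 / 5"] square[of "1 / 5"] ramanujan_gap_upper_at_1_5
        by (simp add: power_divide)
    next
      case False
      then have "ramanujan_slope (1 / 30) x * (1 / 48 - x) \<ge> 0"
        using 2 by (intro mult_nonpos_nonpos) auto
      then show ?thesis
        using lower[of "1 / 48"] square[of "1 / 48"] ramanujan_gap_upper_at_1_48
        by (simp add: power_divide)
    qed
  next
    case 3
    have "ramanujan_gap (1 / 30) x \<le> ramanujan_gap (1 / 30) 1 + ramanujan_slope (1 / 30) 1 * (x - 1)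
        + 0 / 2 * (x - 1)\<^sup>2"
      by (rule taylor_quadratic_upper[of "{1 / 5..1}" _ _ "ramanujan_curvature (1 / 30)"])
        (use 3 assms in \<open>auto intro!: d ramanujan_curvature_upper_right\<close>)
    moreover have "ramanujan_slope (1 / 30) 1 * (x - 1) \<le> 0"
      using ramanujan_slope_lower_at_1 assms by (intro mult_nonneg_nonpos) auto
    ultimately show ?thesis using ramanujan_gap_upper_at_1 by simp
  qed
qed

section \<open>Quotients of gamma functions\<close>

lemma Gamma_plus1_pos: "x > 0 \<Longrightarrow> Gamma (x + 1) = x * Gamma (x :: real)"
  by (rule Gamma_plus1) auto

text \<open>Log-convexity between \<open>a\<close> and \<open>a + 1\<close>, where \<open>\<Gamma>(a + 1) = a \<Gamma>(a)\<close>.\<close>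

lemma Gamma_ratio_le:
  fixes a s :: real
  assumes "a > 0" "0 < s" "s < 1"
  shows "Gamma (a + s) \<le> a powr s * Gamma a"
proof -
  have "ln (Gamma ((1 - s) *\<^sub>R a + s *\<^sub>R (a + 1))) \<le> (1 - s) * ln (Gamma a) + s * ln (Gamma (a + 1))"
    using convex_onD[OF log_convex_Gamma_real, of s a "a + 1"] assms by simp
  also have "(1 - s) *\<^sub>R a + s *\<^sub>R (a + 1) = a + s" by (simp add: algebra_simps)
  also have "ln (Gamma (a + 1)) = ln a + ln (Gamma a)"
    using assms Gamma_real_pos[of a]
    by (subst Gamma_plus1_pos, simp, subst ln_mult) (auto simp del: Gamma_real_pos)
  also have "(1 - s) * ln (Gamma a) + s * (ln a + ln (Gamma a)) = ln (a powr s * Gamma a)"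
    using assms Gamma_real_pos[of a]
    by (subst ln_mult) (auto simp: ln_powr algebra_simps simp del: Gamma_real_pos)
  finally show ?thesis using assms by simp
qed

text \<open>The previous inequality between \<open>a + s\<close> and \<open>a + 1\<close>.\<close>

lemma Gamma_ratio_ge:
  fixes a s :: real
  assumes "a > 0" "0 < s" "s < 1"
  shows "a * Gamma a \<le> (a + s) powr (1 - s) * Gamma (a + s)"
  using Gamma_ratio_le[of "a + s" "1 - s"] assms by (simp add: Gamma_plus1_pos)

lemma Gamma_ratio_half_asymptotic:
  fixes x c :: real
  assumes "x > 0"
  shows "(\<lambda>n. (Gamma (x + real n + 1) / Gamma (x + real n + 1 / 2))\<^sup>2 / (x + real n + c)) \<longlonglongrightarrow> 1"
proof -
  have upper: "(Gamma (y + 1) / Gamma (y + 1 / 2))\<^sup>2 \<le> y + 1 / 2" if "y > 0" for y :: real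
  proof -
    have "Gamma (y + 1) / Gamma (y + 1 / 2) \<le> (y + 1 / 2) powr (1 / 2)"
      using Gamma_ratio_le[of "y + 1 / 2" "1 / 2"] that by (simp add: pos_divide_le_eq add_ac)
    then have "(Gamma (y + 1) / Gamma (y + 1 / 2))\<^sup>2 \<le> ((y + 1 / 2) powr (1 / 2))\<^sup>2"
      using that by (intro power_mono) auto
    then show ?thesis using that by (simp add: powr_half_sqrt)
  qed
  have lower: "(y + 1 / 2)\<^sup>2 / (y + 1) \<le> (Gamma (y + 1) / Gamma (y + 1 / 2))\<^sup>2" if "y > 0" for y :: real
  proof -
    have "(y + 1 / 2) / (y + 1) powr (1 / 2) \<le> Gamma (y + 1) / Gamma (y + 1 / 2)"
    proof -
      have cross: "b / c \<le> d / e" if "b * e \<le> c * d" "c > 0" "e > 0" for b c d e :: real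
        using that by (simp add: divide_simps mult.commute)
      have half: "y + 1 / 2 + 1 / 2 = y + 1" by simp
      show ?thesis
        using Gamma_ratio_ge[of "y + 1 / 2" "1 / 2", unfolded half] that by (intro cross) auto
    qed
    then have "((y + 1 / 2) / (y + 1) powr (1 / 2))\<^sup>2 \<le> (Gamma (y + 1) / Gamma (y + 1 / 2))\<^sup>2"
      using that by (intro power_mono) auto
    then show ?thesis using that by (simp add: powr_half_sqrt power_divide)
  qed
  have big: "\<forall>\<^sub>F n in sequentially. x + real n + c > 0" by real_asymp
  show ?thesis
  proof (rule tendsto_sandwich)
    show "\<forall>\<^sub>F n in sequentially. (x + real n + 1 / 2)\<^sup>2 / (x + real n + 1) / (x + real n + c)
        \<le> (Gamma (x + real n + 1) / Gamma (x + real n + 1 / 2))\<^sup>2 / (x + real n + c)"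
      using big by eventually_elim (use assms in \<open>intro divide_right_mono lower, auto\<close>)
    show "\<forall>\<^sub>F n in sequentially. (Gamma (x + real n + 1) / Gamma (x + real n + 1 / 2))\<^sup>2 / (x + real n + c)
        \<le> (x + real n + 1 / 2) / (x + real n + c)"
      using big by eventually_elim (use assms in \<open>intro divide_right_mono upper, auto\<close>)
  qed real_asymp+
qed

lemma Gamma_ratio_half_step:
  fixes y :: real
  assumes "y > 0"
  shows "(Gamma (y + 1 + 1) / Gamma (y + 1 + 1 / 2))\<^sup>2
    = (Gamma (y + 1) / Gamma (y + 1 / 2))\<^sup>2 * ((y + 1) / (y + 1 / 2))\<^sup>2"
proof -
  have "Gamma (y + 1 + 1) = (y + 1) * Gamma (y + 1)" "Gamma (y + 1 + 1 / 2) = (y + 1 / 2) * Gamma (y + 1 / 2)"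
    using Gamma_plus1_pos[of "y + 1"] Gamma_plus1_pos[of "y + 1 / 2"] assms by (simp_all add: add_ac)
  then show ?thesis by (simp only: power_mult_distrib power_divide times_divide_times_eq mult.commute)
qed

text \<open>Here \<open>Q (y + 1) < Q y\<close> amounts to \<open>(y + 1)^2 (y + 1/4) < (y + 1/2)^2 (y + 5/4)\<close>, whose two sides differ
by the constant \<open>1/16\<close>.\<close>

lemma Gamma_ratio_half_lower:
  fixes x :: real
  assumes "x > 0"
  shows "x + 1 / 4 < (Gamma (x + 1) / Gamma (x + 1 / 2))\<^sup>2"
proof -
  define Q where "Q = (\<lambda>y. (Gamma (y + 1) / Gamma (y + 1 / 2))\<^sup>2 / (y + 1 / 4) :: real)"
  have step: "Q (y + 1) < Q y" if "y > 0" for y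
  proof -
    have "((y + 1) / (y + 1 / 2))\<^sup>2 / (y + 1 + 1 / 4) < 1 / (y + 1 / 4)"
      using that by (simp add: power_divide divide_simps) (simp add: power2_eq_square algebra_simps)
    then have "(Gamma (y + 1) / Gamma (y + 1 / 2))\<^sup>2 * (((y + 1) / (y + 1 / 2))\<^sup>2 / (y + 1 + 1 / 4))
        < (Gamma (y + 1) / Gamma (y + 1 / 2))\<^sup>2 * (1 / (y + 1 / 4))"
      using that Gamma_real_pos[of "y + 1"] Gamma_real_pos[of "y + 1 / 2"]
      by (intro mult_strict_left_mono zero_less_power divide_pos_pos) auto
    then show ?thesis
      unfolding Q_def Gamma_ratio_half_step[OF that] by (simp only: mult_1_right times_divide_eq_right)
  qed
  have "decseq (\<lambda>n. Q (x + 1 + real n))"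
    unfolding decseq_Suc_iff using step[of "x + 1 + real _"] assms
    by (auto intro!: less_imp_le simp: add_ac)
  moreover have "(\<lambda>n. Q (x + 1 + real n)) \<longlonglongrightarrow> 1"
    unfolding Q_def using assms by (intro Gamma_ratio_half_asymptotic) auto
  ultimately have "1 \<le> Q (x + 1 + real 0)" by (rule decseq_ge)
  also have "\<dots> < Q x" using step[OF assms] by simp
  finally show ?thesis using assms by (simp add: Q_def pos_less_divide_eq)
qed

text \<open>With \<open>1/3\<close> in place of \<open>1/4\<close> the comparison of \<open>(y + 1)^2 (y + c)\<close> with \<open>(y + 1/2)^2 (y + 1 + c)\<close> is
reversed: now the difference is \<open>y/12\<close>, which is positive.\<close>

lemma Gamma_ratio_half_upper:
  fixes x :: real
  assumes "x > 0"
  shows "(Gamma (x + 1) / Gamma (x + 1 / 2))\<^sup>2 < x + 1 / 3"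
proof -
  define Q where "Q = (\<lambda>y. (Gamma (y + 1) / Gamma (y + 1 / 2))\<^sup>2 / (y + 1 / 3) :: real)"
  have step: "Q y < Q (y + 1)" if "y > 0" for y
  proof -
    have "1 / (y + 1 / 3) < ((y + 1) / (y + 1 / 2))\<^sup>2 / (y + 1 + 1 / 3)"
      using that by (simp add: power_divide divide_simps) (simp add: power2_eq_square algebra_simps)
    then have "(Gamma (y + 1) / Gamma (y + 1 / 2))\<^sup>2 * (1 / (y + 1 / 3))
        < (Gamma (y + 1) / Gamma (y + 1 / 2))\<^sup>2 * (((y + 1) / (y + 1 / 2))\<^sup>2 / (y + 1 + 1 / 3))"
      using that Gamma_real_pos[of "y + 1"] Gamma_real_pos[of "y + 1 / 2"]
      by (intro mult_strict_left_mono zero_less_power divide_pos_pos) auto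
    then show ?thesis
      unfolding Q_def Gamma_ratio_half_step[OF that] by (simp only: mult_1_right times_divide_eq_right)
  qed
  have "incseq (\<lambda>n. Q (x + 1 + real n))"
    unfolding incseq_Suc_iff using step[of "x + 1 + real _"] assms
    by (auto intro!: less_imp_le simp: add_ac)
  moreover have "(\<lambda>n. Q (x + 1 + real n)) \<longlonglongrightarrow> 1"
    unfolding Q_def using assms by (intro Gamma_ratio_half_asymptotic) auto
  ultimately have "Q (x + 1 + real 0) \<le> 1" by (rule incseq_le)
  with step[OF assms] have "Q x < 1" by simp
  then show ?thesis using assms by (simp add: Q_def pos_divide_less_eq)
qed

text \<open>At \<open>1/4\<close> the quotient bounded above is \<open>\<Gamma>(5/4) / \<Gamma>(3/4)\<close>, a quarter of the reciprocal of the one considered here.\<close>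

lemma Gamma_quarter_ratio_lower: "1 / 12 < (Gamma (3 / 4) / Gamma (1 / 4) :: real)\<^sup>2"
proof -
  have shift: "Gamma (1 / 4 + 1) = 1 / 4 * Gamma (1 / 4 :: real)" by (rule Gamma_plus1_pos) simp
  have "(Gamma (1 / 4 + 1) / Gamma (1 / 4 + 1 / 2))\<^sup>2 = 1 / (16 * (Gamma (3 / 4) / Gamma (1 / 4) :: real)\<^sup>2)"
    unfolding shift by (simp add: power_divide)
  with Gamma_ratio_half_upper[of "1 / 4"]
  have "1 / (16 * (Gamma (3 / 4) / Gamma (1 / 4) :: real)\<^sup>2) < 7 / 12" by simp
  moreover have "(Gamma (3 / 4) / Gamma (1 / 4) :: real)\<^sup>2 > 0"
    by (intro zero_less_power divide_pos_pos Gamma_real_pos) auto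
  moreover have "1 / 12 < z" if "1 / (16 * z) < 7 / 12" "z > 0" for z :: real
    using that by (simp add: divide_simps)
  ultimately show ?thesis by blast
qed

text \<open>The exponential form of \<open>stirling_diff (a + 1) < stirling_diff (a + 1/2)\<close>.\<close>

lemma Gamma_ratio_half_exp_upper:
  fixes a :: real
  assumes "a > 0"
  shows "Gamma (a + 1) / Gamma (a + 1 / 2) < (a + 1) powr (a + 1 / 2) / (sqrt (exp 1) * (a + 1 / 2) powr a)"
proof -
  have "stirling_diff (a + 1) < stirling_diff (a + 1 / 2)"
    using assms by (intro stirling_diff_strict_decreasing) auto
  then have "ln_Gamma (a + 1) - ln_Gamma (a + 1 / 2)
      < (a + 1 / 2) * ln (a + 1) - a * ln (a + 1 / 2) - 1 / 2"
    by (simp add: stirling_diff_def field_simps)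
  then have "exp (ln_Gamma (a + 1) - ln_Gamma (a + 1 / 2))
      < exp ((a + 1 / 2) * ln (a + 1) - a * ln (a + 1 / 2) - 1 / 2)" by simp
  also have "exp (ln_Gamma (a + 1) - ln_Gamma (a + 1 / 2)) = Gamma (a + 1) / Gamma (a + 1 / 2)"
    using assms by (simp add: exp_diff Gamma_real_pos_exp)
  also have "exp ((a + 1 / 2) * ln (a + 1) - a * ln (a + 1 / 2) - 1 / 2)
      = (a + 1) powr (a + 1 / 2) / (sqrt (exp 1) * (a + 1 / 2) powr a)"
    using assms by (simp add: exp_diff powr_def powr_half_sqrt[symmetric] mult.commute)
  finally show ?thesis .
qed

section \<open>Bounds for the generalized pi\<close>

lemma ramanujan_approximation_exp:
  fixes c x :: real
  assumes "c > 0" "x > 0"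
  shows "exp (ln pi / 2 + x * ln x - x + ln (ramanujan_cubic c x) / 6)
    = sqrt pi * (x / exp 1) powr x * ramanujan_cubic c x powr (1 / 6)"
proof -
  have "sqrt pi = exp (ln pi / 2)"
    by (simp add: powr_half_sqrt[symmetric] powr_def)
  moreover have "(x / exp 1) powr x = exp (x * ln x - x)"
    using assms by (simp add: powr_def ln_div algebra_simps)
  moreover have "ramanujan_cubic c x powr (1 / 6) = exp (ln (ramanujan_cubic c x) / 6)"
    using ramanujan_cubic_pos[of c x] assms by (simp add: powr_def)
  ultimately show ?thesis by (simp flip: exp_add) 
qed

lemma ramanujan_Gamma_lower:
  fixes x :: real
  assumes "0 < x" "x \<le> 1"
  shows "sqrt pi * (x / exp 1) powr x * ramanujan_cubic (1 / 100) x powr (1 / 6) < Gamma (1 + x)"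
proof -
  have "exp (ln pi / 2 + x * ln x - x + ln (ramanujan_cubic (1 / 100) x) / 6) < exp (ln_Gamma (1 + x))"
    using ramanujan_gap_pos[OF assms] by (simp add: ramanujan_gap_def)
  then show ?thesis
    using assms by (simp add: ramanujan_approximation_exp Gamma_real_pos_exp)
qed

lemma ramanujan_Gamma_upper:
  fixes x :: real
  assumes "0 < x" "x \<le> 1"
  shows "Gamma (1 + x) < sqrt pi * (x / exp 1) powr x * ramanujan_cubic (1 / 30) x powr (1 / 6)"
proof -
  have "exp (ln_Gamma (1 + x)) < exp (ln pi / 2 + x * ln x - x + ln (ramanujan_cubic (1 / 30) x) / 6)"
    using ramanujan_gap_neg[OF assms] by (simp add: ramanujan_gap_def)
  then show ?thesis
    using assms by (simp add: ramanujan_approximation_exp Gamma_real_pos_exp)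
qed

lemma alpha_ramanujan:
  fixes c q :: real
  assumes "q > 1"
  shows "alpha c q = 2 * (sqrt pi * (1 / q / exp 1) powr (1 / q) * ramanujan_cubic c (1 / q) powr (1 / 6))"
proof -
  have "(q * (q + 4) + 8) / q ^ 3 = 8 * (1 / q) ^ 3 + 4 * (1 / q) ^ 2 + 1 / q"
    using assms by (simp add: field_simps eval_nat_numeral)
  moreover have "(1 / q / exp 1) powr (1 / q) = 1 / (exp 1 * q) powr (1 / q)"
    using assms by (simp add: powr_divide powr_mult)
  ultimately show ?thesis by (simp add: alpha_def ramanujan_cubic_def)
qed

lemma pi_pq_Gamma:
  assumes "p > 1" "q > 1"
  shows "pi_pq p q = 2 * Gamma (1 - 1 / p) * Gamma (1 + 1 / q) / Gamma (1 - 1 / p + 1 / q)"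
  using assms Gamma_plus1_pos[of "1 / q"] by (simp add: pi_pq_Beta Beta_def add_ac)

text \<open>If \<open>1 - 1/p\<close> and \<open>1/q\<close> agree, the denominator \<open>\<Gamma>(2/q)\<close> is split by the duplication formula.\<close>

lemma pi_pq_diagonal:
  assumes "p > 1" "q > 1" "1 - 1 / p = 1 / q"
  shows "pi_pq p q = 2 powr (2 - 2 / q) * sqrt pi * (Gamma (1 / q + 1) / Gamma (1 / q + 1 / 2))"
proof -
  define a where "a = 1 / q"
  have a: "a > 0" using assms by (simp add: a_def)
  have pos: "Gamma (2 * a) > 0" "Gamma (a + 1 / 2) > 0" using a by auto
  have "pi_pq p q = 2 * Gamma a * Gamma (a + 1) / Gamma (2 * a)"
    using assms by (simp add: pi_pq_Gamma a_def add_ac)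
  also have "Gamma a / Gamma (2 * a) = 2 powr (1 - 2 * a) * sqrt pi / Gamma (a + 1 / 2)"
    using Gamma_legendre_duplication_real[OF a] pos by (simp add: field_simps)
  then have "2 * Gamma a * Gamma (a + 1) / Gamma (2 * a)
      = 2 * (2 powr (1 - 2 * a) * sqrt pi / Gamma (a + 1 / 2)) * Gamma (a + 1)"
    by (metis times_divide_eq_left times_divide_eq_right mult.assoc mult.commute)
  also have "2 * (2 powr (1 - 2 * a) * sqrt pi / Gamma (a + 1 / 2)) * Gamma (a + 1)
      = (2 powr 1 * 2 powr (1 - 2 * a)) * sqrt pi * (Gamma (a + 1) / Gamma (a + 1 / 2))"
    by simp
  also have "2 powr 1 * 2 powr (1 - 2 * a) = (2 :: real) powr (2 - 2 * a)"
    by (subst powr_add[symmetric]) simp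
  finally show ?thesis by (simp add: a_def)
qed

lemma pi_pq_ramanujan_bounds:
  fixes p q :: real
  assumes p: "p > 1" and q: "q > 1"
  shows "(p / (p - 1)) powr (1 / q) * alpha (1 / 100) q < pi_pq p q"
    and "pi_pq p q < ((p * q + p - q) / (q * (p - 1))) powr (1 - 1 / q)
          * (p / (p - 1)) powr (1 / q) * alpha (1 / 30) q"
proof -
  define a s where "a = 1 - 1 / p" and "s = 1 / q"
  have a: "a > 0" and s: "0 < s" "s < 1" using p q by (auto simp: a_def s_def)
  have pq: "pi_pq p q = 2 * Gamma (1 + s) * (Gamma a / Gamma (a + s))"
    using p q by (simp add: pi_pq_Gamma a_def s_def)
  have inv: "p / (p - 1) = 1 / a" and shift: "(p * q + p - q) / (q * (p - 1)) = (a + s) / a"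
    using p q by (simp_all add: a_def s_def field_simps)
  have pos: "Gamma a > 0" "Gamma (a + s) > 0" "Gamma (1 + s) > 0" using a s by auto
  show "(p / (p - 1)) powr (1 / q) * alpha (1 / 100) q < pi_pq p q"
  proof -
    have "(1 / a) powr s * alpha (1 / 100) q < (1 / a) powr s * (2 * Gamma (1 + s))"
      using ramanujan_Gamma_lower[of s] a s q
      by (intro mult_strict_left_mono) (auto simp: alpha_ramanujan s_def)
    also have "\<dots> \<le> Gamma a / Gamma (a + s) * (2 * Gamma (1 + s))"
    proof (rule mult_right_mono)
      show "(1 / a) powr s \<le> Gamma a / Gamma (a + s)"
        using Gamma_ratio_le[OF a s] pos a by (simp add: powr_divide divide_simps mult.commute)
    qed (use pos in auto)
    finally show ?thesis by (simp add: pq inv s_def mult_ac)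
  qed
  show "pi_pq p q < ((p * q + p - q) / (q * (p - 1))) powr (1 - 1 / q)
          * (p / (p - 1)) powr (1 / q) * alpha (1 / 30) q"
  proof -
    have "Gamma a / Gamma (a + s) \<le> (a + s) powr (1 - s) / a"
      using Gamma_ratio_ge[OF a s] pos a by (simp add: divide_simps mult.commute)
    also have "\<dots> = ((a + s) / a) powr (1 - s) * (1 / a) powr s"
    proof -
      have "a powr (1 - s) * a powr s = a" using a by (simp flip: powr_add)
      then show ?thesis using a s by (simp add: powr_divide)
    qed
    finally have "Gamma a / Gamma (a + s) * (2 * Gamma (1 + s))
        \<le> ((a + s) / a) powr (1 - s) * (1 / a) powr s * (2 * Gamma (1 + s))"
      using pos by (intro mult_right_mono) auto
    also have "\<dots> < ((a + s) / a) powr (1 - s) * (1 / a) powr s * alpha (1 / 30) q"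
    proof (rule mult_strict_left_mono)
      show "2 * Gamma (1 + s) < alpha (1 / 30) q"
        using ramanujan_Gamma_upper[of s] s q by (simp add: alpha_ramanujan s_def)
      show "0 < ((a + s) / a) powr (1 - s) * (1 / a) powr s" using a s by simp
    qed
    finally show ?thesis unfolding pq inv shift by (simp add: s_def mult_ac)
  qed
qed

theorem theorem1p2:
  fixes p q p' :: real
  assumes "p > 1" and "q > 1" and "p' = p / (p - 1)"
  shows "((p / (p - 1)) powr (1 / q) * alpha (1 / 100) q < pi_pq p q \<and>
      pi_pq p q <
        ((p * q + p - q) / (q * (p - 1))) powr (1 - 1 / q)
          * (p / (p - 1)) powr (1 / q) * alpha (1 / 30) q) \<and>
    (2 powr (1 - 2 / p) * sqrt (pi / p * (4 + p)) < pi_pq p' p \<and>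
      pi_pq p' p <
        2 powr (1 - 2 / p)
          * sqrt (pi / p * (4 + p) + (2 * sqrt pi * (Gamma (3 / 4) / Gamma (1 / 4))) ^ 2)) \<and>
    (2 powr (2 / p) * sqrt pi * sqrt (5 / 4 - 1 / p) < pi_pq p p' \<and>
      pi_pq p p' <
        2 powr (2 / p) * sqrt pi
          * ((2 - 1 / p) powr (3 / 2 - 1 / p)
             / (sqrt (exp 1) * (3 / 2 - 1 / p) powr (1 - 1 / p))))"
proof (intro conjI)
  show "(p / (p - 1)) powr (1 / q) * alpha (1 / 100) q < pi_pq p q"
    and "pi_pq p q < ((p * q + p - q) / (q * (p - 1))) powr (1 - 1 / q)
          * (p / (p - 1)) powr (1 / q) * alpha (1 / 30) q"
    by (rule pi_pq_ramanujan_bounds[OF assms(1,2)])+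
  have p': "p' > 1" "1 - 1 / p' = 1 / p" "1 / p' = 1 - 1 / p"
    unfolding assms(3) using assms(1) by (simp_all add: field_simps)
  have ratio_sqrt_lower: "sqrt (x + 1 / 4) < Gamma (x + 1) / Gamma (x + 1 / 2)" if "x > 0" for x :: real
    using Gamma_ratio_half_lower[OF that] that by (intro real_less_lsqrt) auto
  define x where "x = 1 / p"
  define G :: real where "G = Gamma (3 / 4) / Gamma (1 / 4)"
  have x: "x > 0" using assms by (simp add: x_def)
  have half: "2 powr (2 - 2 / p) = 2 powr (1 - 2 / p) * 2"
    using powr_add[of 2 "1 - 2 / p" 1] by (simp add: algebra_simps)
  have scale: "2 * sqrt pi * sqrt y = sqrt (4 * pi * y)" for y
    by (simp add: real_sqrt_mult)
  have diagonal_left: "pi_pq p' p = 2 powr (1 - 2 / p) * (2 * sqrt pi * (Gamma (x + 1) / Gamma (x + 1 / 2)))"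
    using pi_pq_diagonal[of p' p] assms p' by (simp add: half x_def)
  have arg: "pi / p * (4 + p) = 4 * pi * (x + 1 / 4)"
    using assms by (simp add: x_def field_simps)
  show "2 powr (1 - 2 / p) * sqrt (pi / p * (4 + p)) < pi_pq p' p"
    unfolding diagonal_left arg scale[symmetric]
    by (intro mult_strict_left_mono ratio_sqrt_lower x) auto
  have "Gamma (x + 1) / Gamma (x + 1 / 2) < sqrt (x + 1 / 4 + G\<^sup>2)"
    using Gamma_ratio_half_upper[OF x] Gamma_quarter_ratio_lower x
    by (intro real_less_rsqrt) (auto simp: G_def)
  then have "2 powr (1 - 2 / p) * (2 * sqrt pi * (Gamma (x + 1) / Gamma (x + 1 / 2)))
      < 2 powr (1 - 2 / p) * (2 * sqrt pi * sqrt (x + 1 / 4 + G\<^sup>2))"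
    by (intro mult_strict_left_mono) auto
  moreover have "4 * pi * (x + 1 / 4 + G\<^sup>2) = 4 * pi * (x + 1 / 4) + (2 * sqrt pi * G)\<^sup>2"
    by (simp add: power_mult_distrib algebra_simps)
  ultimately show "pi_pq p' p < 2 powr (1 - 2 / p)
      * sqrt (pi / p * (4 + p) + (2 * sqrt pi * (Gamma (3 / 4) / Gamma (1 / 4))) ^ 2)"
    unfolding diagonal_left arg scale G_def[symmetric] by simp
  define a where "a = 1 - 1 / p"
  have a: "a > 0" using assms by (simp add: a_def)
  have diagonal_right: "pi_pq p p' = 2 powr (2 / p) * sqrt pi * (Gamma (a + 1) / Gamma (a + 1 / 2))"
  proof -
    have "2 - 2 / p' = 2 / p" using p'(3) by (simp add: field_simps)
    moreover have "pi_pq p p' = 2 powr (2 - 2 / p') * sqrt pi * (Gamma (a + 1) / Gamma (a + 1 / 2))"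
      using pi_pq_diagonal[of p p'] assms(1) p' by (simp add: a_def)
    ultimately show ?thesis by simp
  qed
  show "2 powr (2 / p) * sqrt pi * sqrt (5 / 4 - 1 / p) < pi_pq p p'"
    unfolding diagonal_right using ratio_sqrt_lower[OF a]
    by (intro mult_strict_left_mono) (auto simp: a_def)
  show "pi_pq p p' < 2 powr (2 / p) * sqrt pi
      * ((2 - 1 / p) powr (3 / 2 - 1 / p) / (sqrt (exp 1) * (3 / 2 - 1 / p) powr (1 - 1 / p)))"
    unfolding diagonal_right using Gamma_ratio_half_exp_upper[OF a]
    by (intro mult_strict_left_mono) (auto simp: a_def)
qed

end
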